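(* Let $\mathcal{M}$ and $\mathcal{M}'$ be monoidal categories and let $(F,\phi_0,\phi_2):\mathcal{M}\to\mathcal{M}'$ be a monoidal functor. Then $F$ induces functors $$\mathrm{Br}F:\mathrm{Br}_{\mathcal{M}}\to\mathrm{Br}_{\mathcal{M}'},\quad \mathrm{Alg}F:\mathrm{Alg}_{\mathcal{M}}\to\mathrm{Alg}_{\mathcal{M}'},\quad \mathrm{BrAlg}F:\mathrm{BrAlg}_{\mathcal{M}}\to\mathrm{BrAlg}_{\mathcal{M}'},\quad \mathrm{BrBialg}F:\mathrm{BrBialg}_{\mathcal{M}}\to\mathrm{BrBialg}_{\mathcal{M}'}$$ which act as $F$ on morphisms and are defined on objects by $$(\mathrm{Br}F)(V,c_V)=(FV,c_{FV}),\quad (\mathrm{Alg}F)(A,m_A,u_A)=(FA,m_{FA},u_{FA}),$$ $$(\mathrm{BrAlg}F)(A,m_A,u_A,c_A)=(FA,m_{FA},u_{FA},c_{FA}),$$ $$(\mathrm{BrBialg}F)(B,m_B,u_B,\Delta_B,\varepsilon_B,c_B)=(FB,m_{FB},u_{FB},\Delta_{FB},\varepsilon_{FB},c_{FB}),$$ where $$c_{FV}:=\phi_2^{-1}(V,V)\circ Fc_V\circ\phi_2(V,V):FV\otimes FV\to FV\otimes FV,\quad m_{FA}:=Fm_A\circ\phi_2(A,A),\quad u_{FA}:=Fu_A\circ\phi_0:\mathbf{1}'\to FA,$$ $$\Delta_{FB}:=\phi_2^{-1}(B,B)\circ F\Delta_B,\quad \varepsilon_{FB}:=\phi_0^{-1}\circ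 F\varepsilon_B:FB\to\mathbf{1}'.$$ Moreover the following equalities of functors hold: $$H'\circ\mathrm{Br}F=F\circ H,\quad \Omega'\circ\mathrm{Alg}F=F\circ\Omega,\quad H'_{\mathrm{Alg}}\circ\mathrm{BrAlg}F=\mathrm{Alg}F\circ H_{\mathrm{Alg}},$$ $$\Omega'_{\mathrm{Br}}\circ\mathrm{BrAlg}F=\mathrm{Br}F\circ\Omega_{\mathrm{Br}},\quad \mho'_{\mathrm{Br}}\circ\mathrm{BrBialg}F=\mathrm{BrAlg}F\circ\mho_{\mathrm{Br}}.$$ Furthermore: 1) The functors $H,\Omega,H_{\mathrm{Alg}},\Omega_{\mathrm{Br}},\mho_{\mathrm{Br}}$ are conservative. 2) $\mathrm{Br}F$, $\mathrm{Alg}F$, $\mathrm{BrAlg}F$ and $\mathrm{BrBialg}F$ are equivalences (respectively category isomorphisms, respectively conservative) whenever $F$ is.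
   Context: A functor is conservative if it reflects isomorphisms. For a monoidal category $(\mathcal{M},\otimes,\mathbf{1},a,l,r)$, with $l_X:\mathbf 1\otimes X\to X$ and $r_X:X\otimes\mathbf 1\to X$, the associativity constraints are suppressed in formulas, and an object also denotes its identity morphism. A monoidal functor means a strong monoidal one: $\phi_2(U,V):FU\otimes' FV\to F(U\otimes V)$ (natural) and $\phi_0:\mathbf 1'\to F\mathbf 1$ are isomorphisms satisfying the usual coherence conditions. Put $\Delta_{\mathbf 1}=l_{\mathbf 1}^{-1}=r_{\mathbf 1}^{-1}$ and $m_{\mathbf 1}=l_{\mathbf 1}=r_{\mathbf 1}$. $\mathrm{Alg}_{\mathcal M}$ is the category of (associative unital) algebras in $\mathcal M$. A braided object in $\mathcal M$ is a pair $(V,c)$ with $c:V\otimes V\to V\otimes V$ invertible such that $(c\otimes V)(V\otimes c)(c\otimes V)=(V\otimes c)(c\otimes V)(V\otimes c)$. A morphism $(V,c_V)\to(W,c_W)$ is $f:V\to W$ with $c_W(f\otimes f)=(f\otimes f)c_V$. These form $\mathrm{Br}_{\mathcal M}$. A braided algebra is $(A,m,u,c)$ with $(A,m,u)$ an algebra, $(A,c)$ a braided object, and $c(m\otimes A)=(A\otimes m)(c\otimes A)(A\otimes c)$, $c(A\otimes m)=(m\otimes A)(A\otimes c)(c\otimes A)$, $c(u\otimes A)l_A^{-1}=(A\otimes u)r_A^{-1}$, $c(A\otimes u)r_A^{-1}=(u\otimes A)l_A^{-1}$. Morphisms are algebra morphisms that are morphisms of braided objects; category $\mathrm{BrAlg}_{\mathcal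 M}$. A braided coalgebra is $(C,\Delta,\varepsilon,c)$ with $(C,\Delta,\varepsilon)$ a coalgebra, $(C,c)$ a braided object, and $(\Delta\otimes C)c=(C\otimes c)(c\otimes C)(C\otimes\Delta)$, $(C\otimes\Delta)c=(c\otimes C)(C\otimes c)(\Delta\otimes C)$, $l_C(\varepsilon\otimes C)c=r_C(C\otimes\varepsilon)$, $r_C(C\otimes\varepsilon)c=l_C(\varepsilon\otimes C)$. Morphisms are coalgebra morphisms that are morphisms of braided objects. A braided bialgebra is $(B,m,u,\Delta,\varepsilon,c)$ with $(B,m,u,c)$ a braided algebra, $(B,\Delta,\varepsilon,c)$ a braided coalgebra, and $\Delta m=(m\otimes m)(B\otimes c\otimes B)(\Delta\otimes\Delta)$, $\Delta u=(u\otimes u)\Delta_{\mathbf 1}$, $\varepsilon m=m_{\mathbf 1}(\varepsilon\otimes\varepsilon)$, $\varepsilon u=\mathrm{Id}_{\mathbf 1}$. Morphisms are morphisms of both braided algebras and braided coalgebras; category $\mathrm{BrBialg}_{\mathcal M}$. Forgetful functors: $H:\mathrm{Br}_{\mathcal M}\to\mathcal M$, $\Omega:\mathrm{Alg}_{\mathcal M}\to\mathcal M$, $H_{\mathrm{Alg}}:\mathrm{BrAlg}_{\mathcal M}\to\mathrm{Alg}_{\mathcal M}$, $\Omega_{\mathrm{Br}}:\mathrm{BrAlg}_{\mathcal M}\to\mathrm{Br}_{\mathcal M}$, $\mho_{\mathrm{Br}}:\mathrm{BrBialg}_{\mathcal M}\to\mathrm{BrAlg}_{\mathcal M}$; primes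 denote the analogous functors for $\mathcal M'$. *)

theory Defs
  imports Main
begin

section \<open>Categories and functors\<close>

record ('o, 'a) cat =
  Obj :: "'o set"
  Arr :: "'a set"
  Dom :: "'a \<Rightarrow> 'o"
  Cod :: "'a \<Rightarrow> 'o"
  Idt :: "'o \<Rightarrow> 'a" ("\<i>\<index>")
  Comp :: "'a \<Rightarrow> 'a \<Rightarrow> 'a" (infixr "\<cdot>\<index>" 60)

definition Hom :: "('o, 'a, 'z) cat_scheme \<Rightarrow> 'o \<Rightarrow> 'o \<Rightarrow> 'a set" where
  "Hom C X Y = {f \<in> Arr C. Dom C f = X \<and> Cod C f = Y}"

text \<open>Nothing is required of the operations outside the carriers.\<close>

locale category =
  fixes C :: "('o, 'a, 'z) cat_scheme" (structure)
  assumes Dom_closed: "f \<in> Arr C \<Longrightarrow> Dom C f \<in> Obj C"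
    and Cod_closed: "f \<in> Arr C \<Longrightarrow> Cod C f \<in> Obj C"
    and Idt_closed: "X \<in> Obj C \<Longrightarrow> \<i> X \<in> Hom C X X"
    and Comp_closed: "f \<in> Hom C X Y \<Longrightarrow> g \<in> Hom C Y Z \<Longrightarrow> g \<cdot> f \<in> Hom C X Z"
    and Idt_left: "f \<in> Hom C X Y \<Longrightarrow> \<i> Y \<cdot> f = f"
    and Idt_right: "f \<in> Hom C X Y \<Longrightarrow> f \<cdot> \<i> X = f"
    and Comp_assoc: "f \<in> Hom C W X \<Longrightarrow> g \<in> Hom C X Y \<Longrightarrow> h \<in> Hom C Y Z \<Longrightarrow>
      (h \<cdot> g) \<cdot> f = h \<cdot> (g \<cdot> f)"

definition inverse_arrows :: "('o, 'a, 'z) cat_scheme \<Rightarrow> 'a \<Rightarrow> 'a \<Rightarrow> bool" where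
  "inverse_arrows C f g \<longleftrightarrow>
     f \<in> Arr C \<and> g \<in> Hom C (Cod C f) (Dom C f) \<and>
     g \<cdot> f = \<i> (Dom C f) \<and> f \<cdot> g = \<i> (Cod C f)" for C (structure)

definition iso :: "('o, 'a, 'z) cat_scheme \<Rightarrow> 'a \<Rightarrow> bool" where
  "iso C f \<longleftrightarrow> (\<exists>g. inverse_arrows C f g)"

text \<open>Meaningful only for isomorphisms of a category, whose inverse is unique.\<close>

definition Inv :: "('o, 'a, 'z) cat_scheme \<Rightarrow> 'a \<Rightarrow> 'a" ("inv\<index> _" [81] 80) where
  "Inv C f = (THE g. inverse_arrows C f g)"

record ('o, 'a, 'p, 'b) fctr =
  OMap :: "'o \<Rightarrow> 'p"
  AMap :: "'a \<Rightarrow> 'b"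

locale cat_functor = source: category C + target: category D
  for C :: "('o, 'a, 'y) cat_scheme" and D :: "('p, 'b, 'z) cat_scheme" +
  fixes F :: "('o, 'a, 'p, 'b) fctr"
  assumes OMap_closed: "X \<in> Obj C \<Longrightarrow> OMap F X \<in> Obj D"
    and AMap_closed: "f \<in> Hom C X Y \<Longrightarrow> AMap F f \<in> Hom D (OMap F X) (OMap F Y)"
    and AMap_Idt: "X \<in> Obj C \<Longrightarrow> AMap F (Idt C X) = Idt D (OMap F X)"
    and AMap_Comp: "f \<in> Hom C X Y \<Longrightarrow> g \<in> Hom C Y Z \<Longrightarrow>
      AMap F (Comp C g f) = Comp D (AMap F g) (AMap F f)"

definition id_functor :: "('o, 'a, 'o, 'a) fctr" where
  "id_functor = \<lparr>OMap = \<lambda>X. X, AMap = \<lambda>f. f\<rparr>"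

definition comp_functor ::
    "('p, 'b, 'q, 'c) fctr \<Rightarrow> ('o, 'a, 'p, 'b) fctr \<Rightarrow> ('o, 'a, 'q, 'c) fctr"
    (infixr "\<circ>\<^sub>F" 55) where
  "G \<circ>\<^sub>F F = \<lparr>OMap = \<lambda>X. OMap G (OMap F X), AMap = \<lambda>f. AMap G (AMap F f)\<rparr>"

text \<open>Values outside the source category are arbitrary, so equality of functors is agreement on
  the objects and the arrows of the source.\<close>

definition functor_eq ::
    "('o, 'a, 'y) cat_scheme \<Rightarrow> ('p, 'b, 'z) cat_scheme \<Rightarrow>
     ('o, 'a, 'p, 'b) fctr \<Rightarrow> ('o, 'a, 'p, 'b) fctr \<Rightarrow> bool" where
  "functor_eq C D F G \<longleftrightarrow> cat_functor C D F \<and> cat_functor C D G \<and>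
     (\<forall>X \<in> Obj C. OMap F X = OMap G X) \<and> (\<forall>f \<in> Arr C. AMap F f = AMap G f)"

definition nat_iso ::
    "('o, 'a, 'y) cat_scheme \<Rightarrow> ('p, 'b, 'z) cat_scheme \<Rightarrow>
     ('o, 'a, 'p, 'b) fctr \<Rightarrow> ('o, 'a, 'p, 'b) fctr \<Rightarrow> ('o \<Rightarrow> 'b) \<Rightarrow> bool" where
  "nat_iso C D F G \<eta> \<longleftrightarrow> cat_functor C D F \<and> cat_functor C D G \<and>
     (\<forall>X \<in> Obj C. \<eta> X \<in> Hom D (OMap F X) (OMap G X) \<and> iso D (\<eta> X)) \<and>
     (\<forall>X Y. \<forall>f \<in> Hom C X Y. Comp D (AMap G f) (\<eta> X) = Comp D (\<eta> Y) (AMap F f))"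

definition is_conservative ::
    "('o, 'a, 'y) cat_scheme \<Rightarrow> ('p, 'b, 'z) cat_scheme \<Rightarrow> ('o, 'a, 'p, 'b) fctr \<Rightarrow> bool" where
  "is_conservative C D F \<longleftrightarrow> cat_functor C D F \<and>
     (\<forall>f \<in> Arr C. iso D (AMap F f) \<longrightarrow> iso C f)"

definition is_equivalence ::
    "('o, 'a, 'y) cat_scheme \<Rightarrow> ('p, 'b, 'z) cat_scheme \<Rightarrow> ('o, 'a, 'p, 'b) fctr \<Rightarrow> bool" where
  "is_equivalence C D F \<longleftrightarrow> cat_functor C D F \<and>
     (\<exists>G. cat_functor D C G \<and>
        (\<exists>\<eta>. nat_iso C C id_functor (G \<circ>\<^sub>F F) \<eta>) \<and>
        (\<exists>\<epsilon>. nat_iso D D (F \<circ>\<^sub>F G) id_functor \<epsilon>))"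

definition is_cat_isomorphism ::
    "('o, 'a, 'y) cat_scheme \<Rightarrow> ('p, 'b, 'z) cat_scheme \<Rightarrow> ('o, 'a, 'p, 'b) fctr \<Rightarrow> bool" where
  "is_cat_isomorphism C D F \<longleftrightarrow> cat_functor C D F \<and>
     (\<exists>G. cat_functor D C G \<and>
        functor_eq C C (G \<circ>\<^sub>F F) id_functor \<and> functor_eq D D (F \<circ>\<^sub>F G) id_functor)"


section \<open>Monoidal categories and monoidal functors\<close>

text \<open>\<open>\<otimes>\<^sub>o\<close> is the tensor product of objects and \<open>\<otimes>\<close> that of morphisms.\<close>

record ('o, 'a) moncat = "('o, 'a) cat" +
  TensO :: "'o \<Rightarrow> 'o \<Rightarrow> 'o" (infixl "\<otimes>\<^sub>o\<index>" 70)
  TensA :: "'a \<Rightarrow> 'a \<Rightarrow> 'a" (infixl "\<otimes>\<index>" 70)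
  Unit :: 'o ("\<one>\<index>")
  Assoc :: "'o \<Rightarrow> 'o \<Rightarrow> 'o \<Rightarrow> 'a" ("\<a>\<index>")
  LUnit :: "'o \<Rightarrow> 'a" ("\<l>\<index>")
  RUnit :: "'o \<Rightarrow> 'a" ("\<r>\<index>")

locale monoidal_category = category M
  for M :: "('o, 'a) moncat" (structure) +
  assumes TensO_closed: "X \<in> Obj M \<Longrightarrow> Y \<in> Obj M \<Longrightarrow> X \<otimes>\<^sub>o Y \<in> Obj M"
    and TensA_closed: "f \<in> Hom M X Y \<Longrightarrow> g \<in> Hom M X' Y' \<Longrightarrow>
      f \<otimes> g \<in> Hom M (X \<otimes>\<^sub>o X') (Y \<otimes>\<^sub>o Y')"
    and Tens_Idt: "X \<in> Obj M \<Longrightarrow> Y \<in> Obj M \<Longrightarrow> \<i> X \<otimes> \<i> Y = \<i> (X \<otimes>\<^sub>o Y)"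
    and Tens_Comp: "f \<in> Hom M X Y \<Longrightarrow> g \<in> Hom M Y Z \<Longrightarrow>
      f' \<in> Hom M X' Y' \<Longrightarrow> g' \<in> Hom M Y' Z' \<Longrightarrow>
      (g \<cdot> f) \<otimes> (g' \<cdot> f') = (g \<otimes> g') \<cdot> (f \<otimes> f')"
    and Unit_closed: "\<one> \<in> Obj M"
    and Assoc_closed: "X \<in> Obj M \<Longrightarrow> Y \<in> Obj M \<Longrightarrow> Z \<in> Obj M \<Longrightarrow>
      \<a> X Y Z \<in> Hom M ((X \<otimes>\<^sub>o Y) \<otimes>\<^sub>o Z) (X \<otimes>\<^sub>o (Y \<otimes>\<^sub>o Z))"
    and Assoc_iso: "X \<in> Obj M \<Longrightarrow> Y \<in> Obj M \<Longrightarrow> Z \<in> Obj M \<Longrightarrow> iso M (\<a> X Y Z)"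
    and Assoc_natural: "f \<in> Hom M X X' \<Longrightarrow> g \<in> Hom M Y Y' \<Longrightarrow> h \<in> Hom M Z Z' \<Longrightarrow>
      \<a> X' Y' Z' \<cdot> ((f \<otimes> g) \<otimes> h) = (f \<otimes> (g \<otimes> h)) \<cdot> \<a> X Y Z"
    and LUnit_closed: "X \<in> Obj M \<Longrightarrow> \<l> X \<in> Hom M (\<one> \<otimes>\<^sub>o X) X"
    and LUnit_iso: "X \<in> Obj M \<Longrightarrow> iso M (\<l> X)"
    and LUnit_natural: "f \<in> Hom M X Y \<Longrightarrow> \<l> Y \<cdot> (\<i> \<one> \<otimes> f) = f \<cdot> \<l> X"
    and RUnit_closed: "X \<in> Obj M \<Longrightarrow> \<r> X \<in> Hom M (X \<otimes>\<^sub>o \<one>) X"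
    and RUnit_iso: "X \<in> Obj M \<Longrightarrow> iso M (\<r> X)"
    and RUnit_natural: "f \<in> Hom M X Y \<Longrightarrow> \<r> Y \<cdot> (f \<otimes> \<i> \<one>) = f \<cdot> \<r> X"
    and pentagon: "W \<in> Obj M \<Longrightarrow> X \<in> Obj M \<Longrightarrow> Y \<in> Obj M \<Longrightarrow> Z \<in> Obj M \<Longrightarrow>
      (\<i> W \<otimes> \<a> X Y Z) \<cdot> \<a> W (X \<otimes>\<^sub>o Y) Z \<cdot> (\<a> W X Y \<otimes> \<i> Z) =
      \<a> W X (Y \<otimes>\<^sub>o Z) \<cdot> \<a> (W \<otimes>\<^sub>o X) Y Z"
    and triangle: "X \<in> Obj M \<Longrightarrow> Y \<in> Obj M \<Longrightarrow>
      (\<i> X \<otimes> \<l> Y) \<cdot> \<a> X \<one> Y = \<r> X \<otimes> \<i> Y"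

locale monoidal_functor =
  source: monoidal_category M + target: monoidal_category M' + cat_functor M M' F
  for M :: "('o, 'a) moncat" and M' :: "('p, 'b) moncat" (structure)
    and F :: "('o, 'a, 'p, 'b) fctr" +
  fixes \<phi>0 :: 'b and \<phi>2 :: "'o \<Rightarrow> 'o \<Rightarrow> 'b"
  assumes phi0_closed: "\<phi>0 \<in> Hom M' \<one> (OMap F \<one>\<^bsub>M\<^esub>)"
    and phi0_iso: "iso M' \<phi>0"
    and phi2_closed: "U \<in> Obj M \<Longrightarrow> V \<in> Obj M \<Longrightarrow>
      \<phi>2 U V \<in> Hom M' (OMap F U \<otimes>\<^sub>o OMap F V) (OMap F (U \<otimes>\<^sub>o\<^bsub>M\<^esub> V))"
    and phi2_iso: "U \<in> Obj M \<Longrightarrow> V \<in> Obj M \<Longrightarrow> iso M' (\<phi>2 U V)"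
    and phi2_natural: "f \<in> Hom M U U' \<Longrightarrow> g \<in> Hom M V V' \<Longrightarrow>
      \<phi>2 U' V' \<cdot> (AMap F f \<otimes> AMap F g) = AMap F (f \<otimes>\<^bsub>M\<^esub> g) \<cdot> \<phi>2 U V"
    and phi2_assoc: "U \<in> Obj M \<Longrightarrow> V \<in> Obj M \<Longrightarrow> W \<in> Obj M \<Longrightarrow>
      \<phi>2 U (V \<otimes>\<^sub>o\<^bsub>M\<^esub> W) \<cdot> (\<i> (OMap F U) \<otimes> \<phi>2 V W) \<cdot> \<a> (OMap F U) (OMap F V) (OMap F W) =
      AMap F (\<a>\<^bsub>M\<^esub> U V W) \<cdot> \<phi>2 (U \<otimes>\<^sub>o\<^bsub>M\<^esub> V) W \<cdot> (\<phi>2 U V \<otimes> \<i> (OMap F W))"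
    and phi_LUnit: "U \<in> Obj M \<Longrightarrow>
      AMap F (\<l>\<^bsub>M\<^esub> U) \<cdot> \<phi>2 \<one>\<^bsub>M\<^esub> U \<cdot> (\<phi>0 \<otimes> \<i> (OMap F U)) = \<l> (OMap F U)"
    and phi_RUnit: "U \<in> Obj M \<Longrightarrow>
      AMap F (\<r>\<^bsub>M\<^esub> U) \<cdot> \<phi>2 U \<one>\<^bsub>M\<^esub> \<cdot> (\<i> (OMap F U) \<otimes> \<phi>0) = \<r> (OMap F U)"


section \<open>Algebras, coalgebras and braided structures\<close>

text \<open>The usual formulas suppress the associativity constraints. They are restored here; by
  Mac Lane coherence the choice of bracketing does not matter.\<close>

definition is_algebra :: "('o, 'a) moncat \<Rightarrow> 'o \<Rightarrow> 'a \<Rightarrow> 'a \<Rightarrow> bool" where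
  "is_algebra M A m u \<longleftrightarrow>
     A \<in> Obj M \<and> m \<in> Hom M (A \<otimes>\<^sub>o A) A \<and> u \<in> Hom M \<one> A \<and>
     m \<cdot> (m \<otimes> \<i> A) = m \<cdot> (\<i> A \<otimes> m) \<cdot> \<a> A A A \<and>
     m \<cdot> (u \<otimes> \<i> A) = \<l> A \<and>
     m \<cdot> (\<i> A \<otimes> u) = \<r> A" for M (structure)

definition is_coalgebra :: "('o, 'a) moncat \<Rightarrow> 'o \<Rightarrow> 'a \<Rightarrow> 'a \<Rightarrow> bool" where
  "is_coalgebra M C \<Delta> \<epsilon> \<longleftrightarrow>
     C \<in> Obj M \<and> \<Delta> \<in> Hom M C (C \<otimes>\<^sub>o C) \<and> \<epsilon> \<in> Hom M C \<one> \<and>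
     \<a> C C C \<cdot> (\<Delta> \<otimes> \<i> C) \<cdot> \<Delta> = (\<i> C \<otimes> \<Delta>) \<cdot> \<Delta> \<and>
     \<l> C \<cdot> (\<epsilon> \<otimes> \<i> C) \<cdot> \<Delta> = \<i> C \<and>
     \<r> C \<cdot> (\<i> C \<otimes> \<epsilon>) \<cdot> \<Delta> = \<i> C" for M (structure)

definition is_braided_object :: "('o, 'a) moncat \<Rightarrow> 'o \<Rightarrow> 'a \<Rightarrow> bool" where
  "is_braided_object M V c \<longleftrightarrow>
     V \<in> Obj M \<and> c \<in> Hom M (V \<otimes>\<^sub>o V) (V \<otimes>\<^sub>o V) \<and> iso M c \<and>
     (c \<otimes> \<i> V) \<cdot> inv (\<a> V V V) \<cdot> (\<i> V \<otimes> c) \<cdot> \<a> V V V \<cdot> (c \<otimes> \<i> V) =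
     inv (\<a> V V V) \<cdot> (\<i> V \<otimes> c) \<cdot> \<a> V V V \<cdot> (c \<otimes> \<i> V) \<cdot> inv (\<a> V V V) \<cdot> (\<i> V \<otimes> c) \<cdot> \<a> V V V" for M (structure)

definition is_braided_algebra :: "('o, 'a) moncat \<Rightarrow> 'o \<Rightarrow> 'a \<Rightarrow> 'a \<Rightarrow> 'a \<Rightarrow> bool" where
  "is_braided_algebra M A m u c \<longleftrightarrow>
     is_algebra M A m u \<and> is_braided_object M A c \<and>
     c \<cdot> (m \<otimes> \<i> A) =
       (\<i> A \<otimes> m) \<cdot> \<a> A A A \<cdot> (c \<otimes> \<i> A) \<cdot> inv (\<a> A A A) \<cdot> (\<i> A \<otimes> c) \<cdot> \<a> A A A \<and>
     c \<cdot> (\<i> A \<otimes> m) =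
       (m \<otimes> \<i> A) \<cdot> inv (\<a> A A A) \<cdot> (\<i> A \<otimes> c) \<cdot> \<a> A A A \<cdot> (c \<otimes> \<i> A) \<cdot> inv (\<a> A A A) \<and>
     c \<cdot> (u \<otimes> \<i> A) \<cdot> inv (\<l> A) = (\<i> A \<otimes> u) \<cdot> inv (\<r> A) \<and>
     c \<cdot> (\<i> A \<otimes> u) \<cdot> inv (\<r> A) = (u \<otimes> \<i> A) \<cdot> inv (\<l> A)" for M (structure)

definition is_braided_coalgebra :: "('o, 'a) moncat \<Rightarrow> 'o \<Rightarrow> 'a \<Rightarrow> 'a \<Rightarrow> 'a \<Rightarrow> bool" where
  "is_braided_coalgebra M C \<Delta> \<epsilon> c \<longleftrightarrow>
     is_coalgebra M C \<Delta> \<epsilon> \<and> is_braided_object M C c \<and>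
     (\<Delta> \<otimes> \<i> C) \<cdot> c =
       inv (\<a> C C C) \<cdot> (\<i> C \<otimes> c) \<cdot> \<a> C C C \<cdot> (c \<otimes> \<i> C) \<cdot> inv (\<a> C C C) \<cdot> (\<i> C \<otimes> \<Delta>) \<and>
     (\<i> C \<otimes> \<Delta>) \<cdot> c =
       \<a> C C C \<cdot> (c \<otimes> \<i> C) \<cdot> inv (\<a> C C C) \<cdot> (\<i> C \<otimes> c) \<cdot> \<a> C C C \<cdot> (\<Delta> \<otimes> \<i> C) \<and>
     \<l> C \<cdot> (\<epsilon> \<otimes> \<i> C) \<cdot> c = \<r> C \<cdot> (\<i> C \<otimes> \<epsilon>) \<and>
     \<r> C \<cdot> (\<i> C \<otimes> \<epsilon>) \<cdot> c = \<l> C \<cdot> (\<epsilon> \<otimes> \<i> C)" for M (structure)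

text \<open>\<open>B \<otimes> c \<otimes> B\<close> as an endomorphism of \<open>(B \<otimes> B) \<otimes> (B \<otimes> B)\<close>.\<close>

definition middle_braid :: "('o, 'a) moncat \<Rightarrow> 'o \<Rightarrow> 'a \<Rightarrow> 'a" where
  "middle_braid M B c =
     inv (\<a> B B (B \<otimes>\<^sub>o B)) \<cdot>
     (\<i> B \<otimes> (\<a> B B B \<cdot> (c \<otimes> \<i> B) \<cdot> inv (\<a> B B B))) \<cdot>
     \<a> B B (B \<otimes>\<^sub>o B)" for M (structure)

text \<open>\<open>m\<^sub>\<one>\<close> and \<open>\<Delta>\<^sub>\<one>\<close> are rendered as \<open>\<l> \<one>\<close> and its inverse; in a monoidal category
  \<open>\<l> \<one> = \<r> \<one>\<close>.\<close>

definition is_braided_bialgebra ::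
    "('o, 'a) moncat \<Rightarrow> 'o \<Rightarrow> 'a \<Rightarrow> 'a \<Rightarrow> 'a \<Rightarrow> 'a \<Rightarrow> 'a \<Rightarrow> bool" where
  "is_braided_bialgebra M B m u \<Delta> \<epsilon> c \<longleftrightarrow>
     is_braided_algebra M B m u c \<and> is_braided_coalgebra M B \<Delta> \<epsilon> c \<and>
     \<Delta> \<cdot> m = (m \<otimes> m) \<cdot> middle_braid M B c \<cdot> (\<Delta> \<otimes> \<Delta>) \<and>
     \<Delta> \<cdot> u = (u \<otimes> u) \<cdot> inv (\<l> \<one>) \<and>
     \<epsilon> \<cdot> m = \<l> \<one> \<cdot> (\<epsilon> \<otimes> \<epsilon>) \<and>
     \<epsilon> \<cdot> u = \<i> \<one>" for M (structure)

definition br_hom :: "('o, 'a) moncat \<Rightarrow> 'a \<Rightarrow> 'a \<Rightarrow> 'a \<Rightarrow> bool" where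
  "br_hom M c c' f \<longleftrightarrow> c' \<cdot> (f \<otimes> f) = (f \<otimes> f) \<cdot> c" for M (structure)

definition alg_hom :: "('o, 'a) moncat \<Rightarrow> 'a \<Rightarrow> 'a \<Rightarrow> 'a \<Rightarrow> 'a \<Rightarrow> 'a \<Rightarrow> bool" where
  "alg_hom M m u m' u' f \<longleftrightarrow> f \<cdot> m = m' \<cdot> (f \<otimes> f) \<and> f \<cdot> u = u'" for M (structure)

definition coalg_hom :: "('o, 'a) moncat \<Rightarrow> 'a \<Rightarrow> 'a \<Rightarrow> 'a \<Rightarrow> 'a \<Rightarrow> 'a \<Rightarrow> bool" where
  "coalg_hom M \<Delta> \<epsilon> \<Delta>' \<epsilon>' f \<longleftrightarrow> (f \<otimes> f) \<cdot> \<Delta> = \<Delta>' \<cdot> f \<and> \<epsilon>' \<cdot> f = \<epsilon>" for M (structure)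


section \<open>Categories of structured objects\<close>

text \<open>A morphism \<open>f\<close> from a structured object \<open>X\<close> to \<open>Y\<close> is recorded as \<open>(X, f, Y)\<close>, since the same
  \<open>f\<close> may underlie morphisms between different structured objects. The parameters are the set
  \<open>S\<close> of structured objects, the underlying object \<open>U X\<close> and the compatibility condition
  \<open>P X Y f\<close>.\<close>

definition structured_cat ::
    "('o, 'a, 'z) cat_scheme \<Rightarrow> 's set \<Rightarrow> ('s \<Rightarrow> 'o) \<Rightarrow> ('s \<Rightarrow> 's \<Rightarrow> 'a \<Rightarrow> bool) \<Rightarrow>
     ('s, 's \<times> 'a \<times> 's) cat" where
  "structured_cat M S U P =
     \<lparr>Obj = S,
      Arr = {(X, f, Y). X \<in> S \<and> Y \<in> S \<and> f \<in> Hom M (U X) (U Y) \<and> P X Y f},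
      Dom = \<lambda>(X, f, Y). X,
      Cod = \<lambda>(X, f, Y). Y,
      Idt = \<lambda>X. (X, Idt M (U X), X),
      Comp = \<lambda>(Y', g, Z) (X, f, Y). (X, Comp M g f, Z)\<rparr>"

definition Br :: "('o, 'a) moncat \<Rightarrow> ('o \<times> 'a, ('o \<times> 'a) \<times> 'a \<times> ('o \<times> 'a)) cat" where
  "Br M = structured_cat M {(V, c). is_braided_object M V c} (\<lambda>(V, c). V)
     (\<lambda>(V, c) (W, c') f. br_hom M c c' f)"

definition Alg ::
    "('o, 'a) moncat \<Rightarrow> ('o \<times> 'a \<times> 'a, ('o \<times> 'a \<times> 'a) \<times> 'a \<times> ('o \<times> 'a \<times> 'a)) cat" where
  "Alg M = structured_cat M {(A, m, u). is_algebra M A m u} (\<lambda>(A, m, u). A)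
     (\<lambda>(A, m, u) (A', m', u') f. alg_hom M m u m' u' f)"

definition BrAlg ::
    "('o, 'a) moncat \<Rightarrow>
     ('o \<times> 'a \<times> 'a \<times> 'a, ('o \<times> 'a \<times> 'a \<times> 'a) \<times> 'a \<times> ('o \<times> 'a \<times> 'a \<times> 'a)) cat" where
  "BrAlg M = structured_cat M {(A, m, u, c). is_braided_algebra M A m u c} (\<lambda>(A, m, u, c). A)
     (\<lambda>(A, m, u, c) (A', m', u', c') f. alg_hom M m u m' u' f \<and> br_hom M c c' f)"

definition BrBialg ::
    "('o, 'a) moncat \<Rightarrow>
     ('o \<times> 'a \<times> 'a \<times> 'a \<times> 'a \<times> 'a,
      ('o \<times> 'a \<times> 'a \<times> 'a \<times> 'a \<times> 'a) \<times> 'a \<times> ('o \<times> 'a \<times> 'a \<times> 'a \<times> 'a \<times> 'a)) cat" where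
  "BrBialg M = structured_cat M
     {(B, m, u, \<Delta>, \<epsilon>, c). is_braided_bialgebra M B m u \<Delta> \<epsilon> c} (\<lambda>(B, m, u, \<Delta>, \<epsilon>, c). B)
     (\<lambda>(B, m, u, \<Delta>, \<epsilon>, c) (B', m', u', \<Delta>', \<epsilon>', c') f.
        alg_hom M m u m' u' f \<and> coalg_hom M \<Delta> \<epsilon> \<Delta>' \<epsilon>' f \<and> br_hom M c c' f)"


section \<open>Forgetful functors\<close>

text \<open>A functor to the base category forgets to the underlying arrow; a functor between
  categories of structured objects that is given by \<open>T\<close> on objects and by \<open>t\<close> on underlying
  arrows sends \<open>(X, f, Y)\<close> to \<open>(T X, t f, T Y)\<close>.\<close>

definition underlying_functor :: "('s \<Rightarrow> 'o) \<Rightarrow> ('s, 's \<times> 'a \<times> 's, 'o, 'a) fctr" where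
  "underlying_functor U = \<lparr>OMap = U, AMap = \<lambda>(X, f, Y). f\<rparr>"

definition structured_functor ::
    "('s \<Rightarrow> 't) \<Rightarrow> ('a \<Rightarrow> 'b) \<Rightarrow> ('s, 's \<times> 'a \<times> 's, 't, 't \<times> 'b \<times> 't) fctr" where
  "structured_functor T t = \<lparr>OMap = T, AMap = \<lambda>(X, f, Y). (T X, t f, T Y)\<rparr>"

definition H :: "('o \<times> 'a, ('o \<times> 'a) \<times> 'a \<times> ('o \<times> 'a), 'o, 'a) fctr" where
  "H = underlying_functor (\<lambda>(V, c). V)"

definition Omega ::
    "('o \<times> 'a \<times> 'a, ('o \<times> 'a \<times> 'a) \<times> 'a \<times> ('o \<times> 'a \<times> 'a), 'o, 'a) fctr" where
  "Omega = underlying_functor (\<lambda>(A, m, u). A)"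

definition H_Alg ::
    "('o \<times> 'a \<times> 'a \<times> 'a, ('o \<times> 'a \<times> 'a \<times> 'a) \<times> 'a \<times> ('o \<times> 'a \<times> 'a \<times> 'a),
      'o \<times> 'a \<times> 'a, ('o \<times> 'a \<times> 'a) \<times> 'a \<times> ('o \<times> 'a \<times> 'a)) fctr" where
  "H_Alg = structured_functor (\<lambda>(A, m, u, c). (A, m, u)) (\<lambda>f. f)"

definition Omega_Br ::
    "('o \<times> 'a \<times> 'a \<times> 'a, ('o \<times> 'a \<times> 'a \<times> 'a) \<times> 'a \<times> ('o \<times> 'a \<times> 'a \<times> 'a),
      'o \<times> 'a, ('o \<times> 'a) \<times> 'a \<times> ('o \<times> 'a)) fctr" where
  "Omega_Br = structured_functor (\<lambda>(A, m, u, c). (A, c)) (\<lambda>f. f)"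

definition Mho_Br ::
    "('o \<times> 'a \<times> 'a \<times> 'a \<times> 'a \<times> 'a,
      ('o \<times> 'a \<times> 'a \<times> 'a \<times> 'a \<times> 'a) \<times> 'a \<times> ('o \<times> 'a \<times> 'a \<times> 'a \<times> 'a \<times> 'a),
      'o \<times> 'a \<times> 'a \<times> 'a, ('o \<times> 'a \<times> 'a \<times> 'a) \<times> 'a \<times> ('o \<times> 'a \<times> 'a \<times> 'a)) fctr" where
  "Mho_Br = structured_functor (\<lambda>(B, m, u, \<Delta>, \<epsilon>, c). (B, m, u, c)) (\<lambda>f. f)"


section \<open>Functors induced by a monoidal functor\<close>

definition ind_c ::
    "('p, 'b) moncat \<Rightarrow> ('o, 'a, 'p, 'b) fctr \<Rightarrow> ('o \<Rightarrow> 'o \<Rightarrow> 'b) \<Rightarrow> 'o \<Rightarrow> 'a \<Rightarrow> 'b" where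
  "ind_c M' F \<phi>2 V c = inv (\<phi>2 V V) \<cdot> AMap F c \<cdot> \<phi>2 V V" for M' (structure)

definition ind_m ::
    "('p, 'b) moncat \<Rightarrow> ('o, 'a, 'p, 'b) fctr \<Rightarrow> ('o \<Rightarrow> 'o \<Rightarrow> 'b) \<Rightarrow> 'o \<Rightarrow> 'a \<Rightarrow> 'b" where
  "ind_m M' F \<phi>2 A m = AMap F m \<cdot> \<phi>2 A A" for M' (structure)

definition ind_u :: "('p, 'b) moncat \<Rightarrow> ('o, 'a, 'p, 'b) fctr \<Rightarrow> 'b \<Rightarrow> 'a \<Rightarrow> 'b" where
  "ind_u M' F \<phi>0 u = AMap F u \<cdot> \<phi>0" for M' (structure)

definition ind_Delta ::
    "('p, 'b) moncat \<Rightarrow> ('o, 'a, 'p, 'b) fctr \<Rightarrow> ('o \<Rightarrow> 'o \<Rightarrow> 'b) \<Rightarrow> 'o \<Rightarrow> 'a \<Rightarrow> 'b" where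
  "ind_Delta M' F \<phi>2 B \<Delta> = inv (\<phi>2 B B) \<cdot> AMap F \<Delta>" for M' (structure)

definition ind_eps :: "('p, 'b) moncat \<Rightarrow> ('o, 'a, 'p, 'b) fctr \<Rightarrow> 'b \<Rightarrow> 'a \<Rightarrow> 'b" where
  "ind_eps M' F \<phi>0 \<epsilon> = inv \<phi>0 \<cdot> AMap F \<epsilon>" for M' (structure)

definition BrF ::
    "('p, 'b) moncat \<Rightarrow> ('o, 'a, 'p, 'b) fctr \<Rightarrow> ('o \<Rightarrow> 'o \<Rightarrow> 'b) \<Rightarrow>
     ('o \<times> 'a, ('o \<times> 'a) \<times> 'a \<times> ('o \<times> 'a), 'p \<times> 'b, ('p \<times> 'b) \<times> 'b \<times> ('p \<times> 'b)) fctr" where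
  "BrF M' F \<phi>2 =
     structured_functor (\<lambda>(V, c). (OMap F V, ind_c M' F \<phi>2 V c)) (AMap F)"

definition AlgF ::
    "('p, 'b) moncat \<Rightarrow> ('o, 'a, 'p, 'b) fctr \<Rightarrow> 'b \<Rightarrow> ('o \<Rightarrow> 'o \<Rightarrow> 'b) \<Rightarrow>
     ('o \<times> 'a \<times> 'a, ('o \<times> 'a \<times> 'a) \<times> 'a \<times> ('o \<times> 'a \<times> 'a),
      'p \<times> 'b \<times> 'b, ('p \<times> 'b \<times> 'b) \<times> 'b \<times> ('p \<times> 'b \<times> 'b)) fctr" where
  "AlgF M' F \<phi>0 \<phi>2 =
     structured_functor (\<lambda>(A, m, u). (OMap F A, ind_m M' F \<phi>2 A m, ind_u M' F \<phi>0 u)) (AMap F)"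

definition BrAlgF ::
    "('p, 'b) moncat \<Rightarrow> ('o, 'a, 'p, 'b) fctr \<Rightarrow> 'b \<Rightarrow> ('o \<Rightarrow> 'o \<Rightarrow> 'b) \<Rightarrow>
     ('o \<times> 'a \<times> 'a \<times> 'a, ('o \<times> 'a \<times> 'a \<times> 'a) \<times> 'a \<times> ('o \<times> 'a \<times> 'a \<times> 'a),
      'p \<times> 'b \<times> 'b \<times> 'b, ('p \<times> 'b \<times> 'b \<times> 'b) \<times> 'b \<times> ('p \<times> 'b \<times> 'b \<times> 'b)) fctr" where
  "BrAlgF M' F \<phi>0 \<phi>2 =
     structured_functor
       (\<lambda>(A, m, u, c). (OMap F A, ind_m M' F \<phi>2 A m, ind_u M' F \<phi>0 u, ind_c M' F \<phi>2 A c))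
       (AMap F)"

definition BrBialgF ::
    "('p, 'b) moncat \<Rightarrow> ('o, 'a, 'p, 'b) fctr \<Rightarrow> 'b \<Rightarrow> ('o \<Rightarrow> 'o \<Rightarrow> 'b) \<Rightarrow>
     ('o \<times> 'a \<times> 'a \<times> 'a \<times> 'a \<times> 'a,
      ('o \<times> 'a \<times> 'a \<times> 'a \<times> 'a \<times> 'a) \<times> 'a \<times> ('o \<times> 'a \<times> 'a \<times> 'a \<times> 'a \<times> 'a),
      'p \<times> 'b \<times> 'b \<times> 'b \<times> 'b \<times> 'b,
      ('p \<times> 'b \<times> 'b \<times> 'b \<times> 'b \<times> 'b) \<times> 'b \<times> ('p \<times> 'b \<times> 'b \<times> 'b \<times> 'b \<times> 'b)) fctr" where
  "BrBialgF M' F \<phi>0 \<phi>2 =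
     structured_functor
       (\<lambda>(B, m, u, \<Delta>, \<epsilon>, c).
          (OMap F B, ind_m M' F \<phi>2 B m, ind_u M' F \<phi>0 u,
           ind_Delta M' F \<phi>2 B \<Delta>, ind_eps M' F \<phi>0 \<epsilon>, ind_c M' F \<phi>2 B c))
       (AMap F)"

end

theory Submission
  imports Defs
begin

text \<open>Every axiom of a braided (bi)algebra is an equation between morphisms built from the structure
  maps by composition, tensor products and the constraints. Given \<open>\<theta> : A' \<cong> FA\<close>, the coherence of
  \<open>\<phi>\<^sub>0\<close>, \<open>\<phi>\<^sub>2\<close> extends \<open>\<theta>\<close> to isomorphisms from every tensor expression in \<open>A'\<close> to the image of the same
  expression in \<open>A\<close>. If these commute with the structure maps, then by induction they commute
  with all such morphisms, so that an axiom passes from \<open>A\<close> to \<open>A'\<close>, and from \<open>A'\<close> to \<open>A\<close> when \<open>F\<close> is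
  faithful. For \<open>\<theta> = Id\<close> this yields the induced functors. For general \<open>\<theta>\<close> and fully
  faithful \<open>F\<close> it shows that a structure on \<open>A'\<close> comes, up to \<open>\<theta>\<close>, from a unique structure on \<open>A\<close>,
  whence the claims on equivalences and isomorphisms. Conservativity holds because the inverse of a
  morphism of structured objects is one as well.\<close>

section \<open>Equivalences and isomorphisms of categories\<close>

text \<open>The quasi-inverse of an equivalence \<open>F\<close> is given only as a functor, so it
  cannot be lifted to structured objects until it carries a monoidal structure of its own.
  Equivalences are therefore treated as full, faithful and essentially surjective functors, and
  isomorphisms as fully faithful functors bijective on objects: these properties can be lifted by
  speaking of \<open>F\<close> and its \<phi> alone. Essential surjectivity forces \<theta> to be a
  general isomorphism, because a structured object of the target lies over some \<open>A'\<close>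
  that is merely isomorphic to an \<open>FA\<close>. For isomorphisms of categories \<theta> is an
  identity, and structures must then agree on the nose; this is the role of the amnestic conditions,
  which say that a morphism over an identity is an equality of structures. Invertibility of the
  braiding is the one requirement that is not an equation between formal morphisms. It passes from
  \<open>A\<close> to \<open>A'\<close> because functors preserve isomorphisms, and back because a
  fully faithful functor is conservative.\<close>

context category
begin

lemma Hom_Obj: "f \<in> Hom C X Y \<Longrightarrow> X \<in> Obj C \<and> Y \<in> Obj C"
  by (auto simp: Hom_def Dom_closed Cod_closed)

lemma Idt_simps [simp]:
  assumes "X \<in> Obj C" shows "\<i> X \<in> Arr C" "Dom C (\<i> X) = X" "Cod C (\<i> X) = X"
  using Idt_closed[OF assms] by (auto simp: Hom_def)

lemma Comp_simps [simp]:
  assumes "f \<in> Arr C" "g \<in> Arr C" "Dom C g = Cod C f"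
  shows "g \<cdot> f \<in> Arr C" "Dom C (g \<cdot> f) = Dom C f" "Cod C (g \<cdot> f) = Cod C g"
  using Comp_closed[of f "Dom C f" "Cod C f" g "Cod C g"] assms by (auto simp: Hom_def)

lemma Idt_left_simp [simp]: "f \<in> Arr C \<Longrightarrow> Cod C f = Y \<Longrightarrow> \<i> Y \<cdot> f = f"
  by (rule Idt_left[of f "Dom C f"]) (simp add: Hom_def)

lemma Idt_right_simp [simp]: "f \<in> Arr C \<Longrightarrow> Dom C f = X \<Longrightarrow> f \<cdot> \<i> X = f"
  by (rule Idt_right[of f _ "Cod C f"]) (simp add: Hom_def)

lemma Comp_assoc_simp [simp]:
  "f \<in> Arr C \<Longrightarrow> g \<in> Arr C \<Longrightarrow> h \<in> Arr C \<Longrightarrow> Dom C g = Cod C f \<Longrightarrow> Dom C h = Cod C g \<Longrightarrow>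
   (h \<cdot> g) \<cdot> f = h \<cdot> (g \<cdot> f)"
  by (rule Comp_assoc[of f "Dom C f" "Cod C f" g "Cod C g" h "Cod C h"]) (simp_all add: Hom_def)

lemma inverse_arrows_iff:
  "f \<in> Hom C X Y \<Longrightarrow>
   inverse_arrows C f g \<longleftrightarrow> g \<in> Hom C Y X \<and> g \<cdot> f = \<i> X \<and> f \<cdot> g = \<i> Y"
  by (auto simp: inverse_arrows_def Hom_def)

lemma inverse_arrows_unique:
  assumes "inverse_arrows C f g" "inverse_arrows C f h" shows "g = h"
proof -
  have "g = g \<cdot> (f \<cdot> h)" using assms by (auto simp: inverse_arrows_def Hom_def)
  also have "\<dots> = (g \<cdot> f) \<cdot> h"
    using assms by (subst Comp_assoc_simp) (auto simp: inverse_arrows_def Hom_def)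
  also have "\<dots> = h" using assms by (auto simp: inverse_arrows_def Hom_def)
  finally show ?thesis .
qed

lemma inverse_arrows_Inv: "iso C f \<Longrightarrow> inverse_arrows C f (Inv C f)"
  unfolding iso_def Inv_def by (metis inverse_arrows_unique theI)

lemma Inv_simps [simp]:
  assumes "iso C f"
  shows "Inv C f \<in> Arr C" "Dom C (Inv C f) = Cod C f" "Cod C (Inv C f) = Dom C f"
    "Inv C f \<cdot> f = \<i> (Dom C f)" "f \<cdot> Inv C f = \<i> (Cod C f)"
  using inverse_arrows_Inv[OF assms] by (auto simp: inverse_arrows_def Hom_def)

lemma iso_Arr: "iso C f \<Longrightarrow> f \<in> Arr C"
  by (auto simp: iso_def inverse_arrows_def)

lemma Inv_cancel [simp]:
  assumes "iso C f" "g \<in> Arr C"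
  shows "Cod C g = Dom C f \<Longrightarrow> Inv C f \<cdot> f \<cdot> g = g"
    and "Cod C g = Cod C f \<Longrightarrow> f \<cdot> Inv C f \<cdot> g = g"
  using assms iso_Arr[OF assms(1)] by (simp_all flip: Comp_assoc_simp)

lemma Inv_closed: "iso C f \<Longrightarrow> f \<in> Hom C X Y \<Longrightarrow> Inv C f \<in> Hom C Y X"
  by (auto simp: Hom_def)

lemma isoI:
  "f \<in> Hom C X Y \<Longrightarrow> g \<in> Hom C Y X \<Longrightarrow> g \<cdot> f = \<i> X \<Longrightarrow> f \<cdot> g = \<i> Y \<Longrightarrow> iso C f"
  unfolding iso_def using inverse_arrows_iff by blast

lemma iso_Idt [simp]: "X \<in> Obj C \<Longrightarrow> iso C (\<i> X)"
  by (rule isoI[of _ X X "\<i> X"]) (auto simp: Hom_def)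

lemma iso_Inv [simp]: "iso C f \<Longrightarrow> iso C (Inv C f)"
  by (rule isoI[of _ "Cod C f" "Dom C f" f]) (auto simp: Hom_def iso_Arr)

lemma iso_Comp [simp]:
  "iso C f \<Longrightarrow> iso C g \<Longrightarrow> Dom C g = Cod C f \<Longrightarrow> iso C (g \<cdot> f)"
  by (rule isoI[of _ "Dom C f" "Cod C g" "Inv C f \<cdot> Inv C g"]) (auto simp: Hom_def iso_Arr)

lemma iso_cancel_left:
  assumes "iso C f" "f \<cdot> g = f \<cdot> h" "g \<in> Arr C" "h \<in> Arr C" "Cod C g = Dom C f" "Cod C h = Dom C f"
  shows "g = h"
proof -
  have "g = Inv C f \<cdot> f \<cdot> g" using assms(1,3,5) by simp
  also have "\<dots> = h" unfolding assms(2) using assms(1,4,6) by simp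
  finally show ?thesis .
qed

lemma iso_cancel_right:
  assumes "iso C f" "g \<cdot> f = h \<cdot> f" "g \<in> Arr C" "h \<in> Arr C" "Dom C g = Cod C f" "Dom C h = Cod C f"
  shows "g = h"
proof -
  have "g = (g \<cdot> f) \<cdot> Inv C f" using assms(1,3,5) by (simp add: iso_Arr)
  also have "\<dots> = h" unfolding assms(2) using assms(1,4,6) by (simp add: iso_Arr)
  finally show ?thesis .
qed

text \<open>Compose the commuting square with the inverses of its two invertible opposite sides.
  This is how statements about constraints, natural isomorphisms and structured morphisms pass to
  the inverses.\<close>

lemma square_Inv:
  assumes "iso C f" "iso C f'" "y \<cdot> f' = f \<cdot> x"
    and "x \<in> Hom C (Dom C f') (Dom C f)" "y \<in> Hom C (Cod C f') (Cod C f)"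
  shows "x \<cdot> Inv C f' = Inv C f \<cdot> y"
proof -
  have "x \<cdot> Inv C f' = Inv C f \<cdot> (f \<cdot> x) \<cdot> Inv C f'"
    using assms by (simp add: Hom_def iso_Arr)
  also have "\<dots> = Inv C f \<cdot> y"
    using assms(1,2,4,5) unfolding assms(3)[symmetric] by (simp add: Hom_def iso_Arr)
  finally show ?thesis .
qed

end

section \<open>Functors and their effect on isomorphisms\<close>

context cat_functor
begin

lemma OMap_simp [simp]: "X \<in> Obj C \<Longrightarrow> OMap F X \<in> Obj D"
  by (rule OMap_closed)

lemma AMap_simps [simp]:
  assumes "f \<in> Arr C"
  shows "AMap F f \<in> Arr D" "Dom D (AMap F f) = OMap F (Dom C f)"
    "Cod D (AMap F f) = OMap F (Cod C f)"
  using AMap_closed[of f "Dom C f" "Cod C f"] assms by (auto simp: Hom_def)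

lemma AMap_Comp_simp:
  "f \<in> Arr C \<Longrightarrow> g \<in> Arr C \<Longrightarrow> Dom C g = Cod C f \<Longrightarrow>
   AMap F (Comp C g f) = Comp D (AMap F g) (AMap F f)"
  by (rule AMap_Comp[of f "Dom C f" "Cod C f" g "Cod C g"]) (simp_all add: Hom_def)

lemma iso_AMap: 
  assumes "iso C f" shows "iso D (AMap F f)"
proof -
  have a: "f \<in> Arr C" by (rule source.iso_Arr[OF assms])
  show ?thesis
    using assms a AMap_Comp_simp[of f "Inv C f"] AMap_Comp_simp[of "Inv C f" f]
    by (intro target.isoI[of _ "OMap F (Dom C f)" "OMap F (Cod C f)" "AMap F (Inv C f)"])
      (auto simp: Hom_def AMap_Idt source.Dom_closed source.Cod_closed)
qed

lemma AMap_Inv: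
  assumes "iso C f" shows "AMap F (Inv C f) = Inv D (AMap F f)"
proof (rule target.inverse_arrows_unique)
  show "inverse_arrows D (AMap F f) (Inv D (AMap F f))"
    by (rule target.inverse_arrows_Inv[OF iso_AMap[OF assms]])
  have "f \<in> Arr C" by (rule source.iso_Arr[OF assms])
  then show "inverse_arrows D (AMap F f) (AMap F (Inv C f))"
    using assms AMap_Comp_simp[of f "Inv C f"] AMap_Comp_simp[of "Inv C f" f]
    by (auto simp: inverse_arrows_def Hom_def AMap_Idt source.Dom_closed source.Cod_closed)
qed

end

lemma cat_functor_id: "category C \<Longrightarrow> cat_functor C C id_functor"
  by (simp add: cat_functor_def cat_functor_axioms_def id_functor_def)

lemma cat_functor_comp:
  assumes "cat_functor C D F" "cat_functor D E G"
  shows "cat_functor C E (G \<circ>\<^sub>F F)"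
proof -
  interpret F: cat_functor C D F by fact
  interpret G: cat_functor D E G by fact
  show ?thesis
  proof
    show "AMap (G \<circ>\<^sub>F F) (Comp C g f) = Comp E (AMap (G \<circ>\<^sub>F F) g) (AMap (G \<circ>\<^sub>F F) f)"
      if "f \<in> Hom C X Y" "g \<in> Hom C Y Z" for f g X Y Z
      using that by (simp add: comp_functor_def Hom_def F.AMap_Comp_simp G.AMap_Comp_simp)
  qed (simp_all add: comp_functor_def F.AMap_closed G.AMap_closed F.AMap_Idt G.AMap_Idt)
qed

lemma is_conservative_id: "category C \<Longrightarrow> is_conservative C C id_functor"
  by (simp add: is_conservative_def cat_functor_id) (simp add: id_functor_def)

section \<open>Full, faithful and essentially surjective functors\<close>

definition faithful ::
    "('o, 'a, 'y) cat_scheme \<Rightarrow> ('p, 'b, 'z) cat_scheme \<Rightarrow> ('o, 'a, 'p, 'b) fctr \<Rightarrow> bool" where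
  "faithful C D F \<longleftrightarrow>
     (\<forall>X Y. \<forall>f \<in> Hom C X Y. \<forall>g \<in> Hom C X Y. AMap F f = AMap F g \<longrightarrow> f = g)"

definition full ::
    "('o, 'a, 'y) cat_scheme \<Rightarrow> ('p, 'b, 'z) cat_scheme \<Rightarrow> ('o, 'a, 'p, 'b) fctr \<Rightarrow> bool" where
  "full C D F \<longleftrightarrow>
     (\<forall>X \<in> Obj C. \<forall>Y \<in> Obj C. \<forall>h \<in> Hom D (OMap F X) (OMap F Y). \<exists>f \<in> Hom C X Y. AMap F f = h)"

definition essentially_surjective ::
    "('o, 'a, 'y) cat_scheme \<Rightarrow> ('p, 'b, 'z) cat_scheme \<Rightarrow> ('o, 'a, 'p, 'b) fctr \<Rightarrow> bool" where
  "essentially_surjective C D F \<longleftrightarrow>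
     (\<forall>Y \<in> Obj D. \<exists>X \<in> Obj C. \<exists>e \<in> Hom D (OMap F X) Y. iso D e)"

lemma faithfulD:
  "faithful C D F \<Longrightarrow> AMap F f = AMap F g \<Longrightarrow> f \<in> Hom C X Y \<Longrightarrow> g \<in> Hom C X Y \<Longrightarrow> f = g"
  unfolding faithful_def by blast

lemma fullE:
  assumes "full C D F" "X \<in> Obj C" "Y \<in> Obj C" "h \<in> Hom D (OMap F X) (OMap F Y)"
  obtains f where "f \<in> Hom C X Y" "AMap F f = h"
  using assms unfolding full_def by blast

lemma nat_iso_natural:
  "nat_iso C D F G \<eta> \<Longrightarrow> f \<in> Hom C X Y \<Longrightarrow> Comp D (AMap G f) (\<eta> X) = Comp D (\<eta> Y) (AMap F f)"
  unfolding nat_iso_def by blast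

lemma nat_iso_component:
  assumes "nat_iso C D F G \<eta>" "X \<in> Obj C"
  shows "\<eta> X \<in> Hom D (OMap F X) (OMap G X)" "iso D (\<eta> X)"
  using assms unfolding nat_iso_def by blast+

text \<open>By naturality \<open>G f\<close> determines the composite of \<open>F f\<close> with
  \<eta> at the codomain, and this component of \<eta> can be cancelled.\<close>

lemma nat_iso_faithful:
  assumes "nat_iso C C F G \<eta>" "faithful C C F" shows "faithful C C G"
  unfolding faithful_def
proof (intro allI ballI impI)
  fix X Y f g assume f: "f \<in> Hom C X Y" and g: "g \<in> Hom C X Y" and e: "AMap G f = AMap G g"
  interpret F: cat_functor C C F using assms by (simp add: nat_iso_def)
  have o: "X \<in> Obj C" "Y \<in> Obj C" using f F.source.Hom_Obj by auto
  have n: "iso C (\<eta> Y)" "\<eta> Y \<in> Hom C (OMap F Y) (OMap G Y)"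
    using nat_iso_component[OF assms(1) o(2)] by auto
  have "Comp C (\<eta> Y) (AMap F f) = Comp C (\<eta> Y) (AMap F g)"
    using nat_iso_natural[OF assms(1) f] nat_iso_natural[OF assms(1) g] e by simp
  from F.source.iso_cancel_left[OF n(1) this] n f g have "AMap F f = AMap F g"
    by (simp add: Hom_def)
  from faithfulD[OF assms(2) this f g] show "f = g" .
qed

lemma faithful_id: "faithful C C id_functor"
  by (simp add: faithful_def id_functor_def)

lemma faithful_comp_first:
  assumes "faithful C E (G \<circ>\<^sub>F F)" shows "faithful C D F"
  unfolding faithful_def
proof (intro allI ballI impI)
  fix X Y f g assume f: "f \<in> Hom C X Y" and g: "g \<in> Hom C X Y" and eq: "AMap F f = AMap F g"
  have "AMap (G \<circ>\<^sub>F F) f = AMap (G \<circ>\<^sub>F F) g" by (simp add: comp_functor_def eq)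
  from faithfulD[OF assms this f g] show "f = g" .
qed

text \<open>The identity is faithful, hence so is the isomorphic functor \<open>GF\<close>, hence so
  is the factor \<open>F\<close> that is applied first.\<close>

lemma is_equivalence_faithful:
  assumes "is_equivalence C D F" shows "faithful C D F"
proof -
  obtain G \<eta> where "nat_iso C C id_functor (G \<circ>\<^sub>F F) \<eta>"
    using assms unfolding is_equivalence_def by blast
  then show ?thesis by (rule faithful_comp_first[OF nat_iso_faithful[OF _ faithful_id]])
qed

lemma nat_iso_sym:
  assumes "nat_iso C D F G \<eta>" shows "nat_iso C D G F (\<lambda>X. Inv D (\<eta> X))"
  unfolding nat_iso_def
proof (intro conjI ballI allI)
  interpret F: cat_functor C D F using assms by (simp add: nat_iso_def)
  interpret G: cat_functor C D G using assms by (simp add: nat_iso_def)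
  show "cat_functor C D F" "cat_functor C D G" by unfold_locales
  fix X assume "X \<in> Obj C"
  then show "Inv D (\<eta> X) \<in> Hom D (OMap G X) (OMap F X)" "iso D (Inv D (\<eta> X))"
    using nat_iso_component[OF assms] F.target.Inv_closed F.target.iso_Inv by blast+
next
  interpret F: cat_functor C D F using assms by (simp add: nat_iso_def)
  interpret G: cat_functor C D G using assms by (simp add: nat_iso_def)
  fix X Y f assume f: "f \<in> Hom C X Y"
  have o: "X \<in> Obj C" "Y \<in> Obj C" using f F.source.Hom_Obj by auto
  show "Comp D (AMap F f) (Inv D (\<eta> X)) = Comp D (Inv D (\<eta> Y)) (AMap G f)"
    by (rule F.target.square_Inv)
      (use nat_iso_natural[OF assms f] nat_iso_component[OF assms o(1)]
        nat_iso_component[OF assms o(2)] f in \<open>simp_all add: Hom_def\<close>)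
qed

text \<open>A preimage of \<open>h\<close> is found by conjugating \<open>G h\<close> with the unit;
  that \<open>F\<close> sends it to \<open>h\<close> is checked after applying \<open>G\<close>,
  which is faithful.\<close>

lemma is_equivalence_full:
  assumes "is_equivalence C D F" shows "full C D F"
  unfolding full_def
proof (intro ballI)
  obtain G \<eta> \<epsilon> where G: "cat_functor D C G" and \<eta>: "nat_iso C C id_functor (G \<circ>\<^sub>F F) \<eta>"
    and \<epsilon>: "nat_iso D D (F \<circ>\<^sub>F G) id_functor \<epsilon>" and F: "cat_functor C D F"
    using assms unfolding is_equivalence_def by blast
  \<comment> \<open>The inverse of \<epsilon> is an isomorphism from the identity to
    \<open>FG\<close>, and \<open>G\<close> is the factor applied first.\<close>
  have G_faithful: "faithful D C G"
    by (rule faithful_comp_first[OF nat_iso_faithful[OF nat_iso_sym[OF \<epsilon>] faithful_id]])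
  interpret F: cat_functor C D F by fact
  interpret G: cat_functor D C G by fact
  fix X Y h assume o: "X \<in> Obj C" "Y \<in> Obj C" and h: "h \<in> Hom D (OMap F X) (OMap F Y)"
  have n: "\<eta> Z \<in> Hom C Z (OMap G (OMap F Z)) \<and> iso C (\<eta> Z)" if "Z \<in> Obj C" for Z
    using nat_iso_component[OF \<eta> that] by (simp add: comp_functor_def id_functor_def)
  note nX = n[OF o(1)] and nY = n[OF o(2)]
  \<comment> \<open>The only candidate: if \<open>F f = h\<close>, then naturality of \<eta> at
    \<open>f\<close> yields this formula.\<close>
  define f where "f = Comp C (Inv C (\<eta> Y)) (Comp C (AMap G h) (\<eta> X))"
  have f: "f \<in> Hom C X Y" using nX nY h by (auto simp: f_def Hom_def)
  have "Comp C (AMap G (AMap F f)) (\<eta> X) = Comp C (\<eta> Y) f"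
    using nat_iso_natural[OF \<eta> f] by (simp add: comp_functor_def id_functor_def)
  also have "\<dots> = Comp C (AMap G h) (\<eta> X)"
    using nX nY h by (auto simp: f_def Hom_def)
  finally have eq: "Comp C (AMap G (AMap F f)) (\<eta> X) = Comp C (AMap G h) (\<eta> X)" .
  have "AMap G (AMap F f) = AMap G h"
    by (rule F.source.iso_cancel_right[OF conjunct2[OF nX] eq])
      (use nX h f in \<open>simp_all add: Hom_def\<close>)
  from faithfulD[OF G_faithful this F.AMap_closed[OF f] h] have "AMap F f = h" .
  with f show "\<exists>f\<in>Hom C X Y. AMap F f = h" by blast
qed

lemma is_equivalence_essentially_surjective:
  assumes "is_equivalence C D F" shows "essentially_surjective C D F"
proof -
  obtain G \<epsilon> where G: "cat_functor D C G" and \<epsilon>: "nat_iso D D (F \<circ>\<^sub>F G) id_functor \<epsilon>"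
    using assms unfolding is_equivalence_def by blast
  have "OMap G Y \<in> Obj C \<and> \<epsilon> Y \<in> Hom D (OMap F (OMap G Y)) Y \<and> iso D (\<epsilon> Y)" if "Y \<in> Obj D" for Y
    using that \<epsilon> cat_functor.OMap_closed[OF G]
    by (simp add: nat_iso_def comp_functor_def id_functor_def)
  then show ?thesis unfolding essentially_surjective_def by blast
qed

text \<open>Fullness lifts the inverse of \<open>F f\<close>, and faithfulness lifts the two
  equations that make it an inverse. The fact yields invertibility of the unit of an equivalence
  and, later, of a braiding pulled back along \<open>F\<close>.\<close>

lemma fully_faithful_conservative:
  assumes "cat_functor C D F" "faithful C D F" "full C D F"
  shows "is_conservative C D F"
  unfolding is_conservative_def
proof (intro conjI ballI impI)
  interpret F: cat_functor C D F by fact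
  fix f assume f: "f \<in> Arr C" and i: "iso D (AMap F f)"
  have o: "Dom C f \<in> Obj C" "Cod C f \<in> Obj C" using f F.source.Dom_closed F.source.Cod_closed by auto
  obtain k where k: "k \<in> Hom C (Cod C f) (Dom C f)" "AMap F k = Inv D (AMap F f)"
    using fullE[OF assms(3) o(2,1), of "Inv D (AMap F f)"] f i by (auto simp: Hom_def)
  have ar: "k \<in> Arr C" "Dom C k = Cod C f" "Cod C k = Dom C f"
    using k by (auto simp: Hom_def)
  have "Comp C k f = Idt C (Dom C f)"
    using faithfulD[OF assms(2), of "Comp C k f" "Idt C (Dom C f)"] k(2) ar f i o
    by (simp add: F.AMap_Comp_simp F.AMap_Idt Hom_def)
  moreover have "Comp C f k = Idt C (Cod C f)"
    using faithfulD[OF assms(2), of "Comp C f k" "Idt C (Cod C f)"] k(2) ar f i o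
    by (simp add: F.AMap_Comp_simp F.AMap_Idt Hom_def)
  ultimately show "iso C f" using F.source.isoI[of f _ _ k] f k by (auto simp: Hom_def)
qed (rule assms(1))

text \<open>The classical converse: choose for every \<open>Y\<close> an object \<open>g Y\<close>
  with an isomorphism \<open>e Y\<close> from \<open>F (g Y)\<close> to \<open>Y\<close>, and extend
  \<open>g\<close> to the unique functor that makes \<open>e\<close> natural.\<close>

lemma is_equivalenceI:
  assumes "cat_functor C D F" "faithful C D F" "full C D F" "essentially_surjective C D F"
  shows "is_equivalence C D F"
proof -
  interpret F: cat_functor C D F by fact
  obtain g e where ge: "\<And>Y. Y \<in> Obj D \<Longrightarrow> g Y \<in> Obj C \<and> e Y \<in> Hom D (OMap F (g Y)) Y \<and> iso D (e Y)"
    using assms(4) unfolding essentially_surjective_def by metis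
  have e [simp]: "g Y \<in> Obj C" "e Y \<in> Arr D" "Dom D (e Y) = OMap F (g Y)" "Cod D (e Y) = Y" "iso D (e Y)"
    if "Y \<in> Obj D" for Y using ge[OF that] by (auto simp: Hom_def)
  \<comment> \<open>Naturality of \<open>e\<close> at \<open>h\<close> forces this value on the
    image of \<open>h\<close> under \<open>FG\<close>.\<close>
  define conj where "conj h = Comp D (Inv D (e (Cod D h))) (Comp D h (e (Dom D h)))" for h
  have conj: "conj h \<in> Hom D (OMap F (g Y)) (OMap F (g Z))" if "h \<in> Hom D Y Z" for h Y Z
    using that by (auto simp: conj_def Hom_def F.target.Dom_closed F.target.Cod_closed)
  \<comment> \<open>Fullness provides such an arrow. Faithfulness makes it unique, so identities and
    composites need only be compared after applying \<open>F\<close>.\<close>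
  define a where "a h = (SOME f. f \<in> Hom C (g (Dom D h)) (g (Cod D h)) \<and> AMap F f = conj h)" for h
  have a: "a h \<in> Hom C (g Y) (g Z) \<and> AMap F (a h) = conj h" if "h \<in> Hom D Y Z" for h Y Z
  proof -
    have "Y \<in> Obj D" "Z \<in> Obj D" using F.target.Hom_Obj[OF that] by auto
    then have "\<exists>f. f \<in> Hom C (g Y) (g Z) \<and> AMap F f = conj h"
      using fullE[OF assms(3) _ _ conj[OF that]] by (metis e(1))
    then have "\<exists>f. f \<in> Hom C (g (Dom D h)) (g (Cod D h)) \<and> AMap F f = conj h"
      using that by (auto simp: Hom_def)
    from someI_ex[OF this] show ?thesis using that by (auto simp: a_def Hom_def)
  qed
  define G where "G = \<lparr>OMap = g, AMap = a\<rparr>"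
  have G: "cat_functor D C G"
  proof
    show "OMap G X \<in> Obj C" if "X \<in> Obj D" for X using that by (simp add: G_def)
    show "AMap G f \<in> Hom C (OMap G X) (OMap G Y)" if "f \<in> Hom D X Y" for f X Y
      using a[OF that] by (simp add: G_def)
    show "AMap G (Idt D X) = Idt C (OMap G X)" if X: "X \<in> Obj D" for X
    proof -
      note i = a[OF F.target.Idt_closed[OF X]]
      have "AMap F (a (Idt D X)) = AMap F (Idt C (g X))"
        using i X by (simp add: conj_def F.AMap_Idt)
      from faithfulD[OF assms(2) this conjunct1[OF i] F.source.Idt_closed] X
      show ?thesis by (simp add: G_def)
    qed
    show "AMap G (Comp D k h) = Comp C (AMap G k) (AMap G h)"
      if h: "h \<in> Hom D X Y" and k: "k \<in> Hom D Y Z" for h k X Y Z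
    proof -
      note kh = F.target.Comp_closed[OF h k]
      have o: "X \<in> Obj D" "Y \<in> Obj D" "Z \<in> Obj D"
        using F.target.Hom_Obj[OF h] F.target.Hom_Obj[OF k] by auto
      have "AMap F (a (Comp D k h)) = AMap F (Comp C (a k) (a h))"
        using a[OF h] a[OF k] a[OF kh] h k o
        by (simp add: F.AMap_Comp[OF conjunct1[OF a[OF h]] conjunct1[OF a[OF k]]] conj_def Hom_def)
      from faithfulD[OF assms(2) this conjunct1[OF a[OF kh]]
          F.source.Comp_closed[OF conjunct1[OF a[OF h]] conjunct1[OF a[OF k]]]]
      show ?thesis by (simp add: G_def)
    qed
  qed
  have \<epsilon>: "nat_iso D D (F \<circ>\<^sub>F G) id_functor e"
    unfolding nat_iso_def
  proof (intro conjI allI ballI)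
    show "cat_functor D D (F \<circ>\<^sub>F G)" by (rule cat_functor_comp[OF G assms(1)])
    show "cat_functor D D id_functor" by (rule cat_functor_id[OF F.target.category_axioms])
    show "e X \<in> Hom D (OMap (F \<circ>\<^sub>F G) X) (OMap id_functor X)" "iso D (e X)" if "X \<in> Obj D" for X
      using that by (auto simp: comp_functor_def id_functor_def G_def Hom_def)
    fix X Y f assume f: "f \<in> Hom D X Y"
    have o: "X \<in> Obj D" "Y \<in> Obj D" using F.target.Hom_Obj[OF f] by auto
    show "Comp D (AMap id_functor f) (e X) = Comp D (e Y) (AMap (F \<circ>\<^sub>F G) f)"
      using a[OF f] f o by (simp add: comp_functor_def id_functor_def G_def Hom_def conj_def)
  qed
  \<comment> \<open>The unit at \<open>X\<close> is the preimage of the inverse counit at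
    \<open>F X\<close>, as a triangle identity demands.\<close>
  have "\<exists>u. u \<in> Hom C X (g (OMap F X)) \<and> AMap F u = Inv D (e (OMap F X))" if "X \<in> Obj C" for X
  proof -
    have "Inv D (e (OMap F X)) \<in> Hom D (OMap F X) (OMap F (g (OMap F X)))"
      using that by (simp add: Hom_def)
    then show ?thesis using fullE[OF assms(3), of X "g (OMap F X)"] that e(1) F.OMap_simp by metis
  qed
  then obtain u where u: "\<And>X. X \<in> Obj C \<Longrightarrow> u X \<in> Hom C X (g (OMap F X)) \<and> AMap F (u X) = Inv D (e (OMap F X))"
    by metis
  have \<eta>: "nat_iso C C id_functor (G \<circ>\<^sub>F F) u"
    unfolding nat_iso_def
  proof (intro conjI allI ballI)
    show "cat_functor C C (G \<circ>\<^sub>F F)" by (rule cat_functor_comp[OF assms(1) G])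
    show "cat_functor C C id_functor" by (rule cat_functor_id[OF F.source.category_axioms])
    show "u X \<in> Hom C (OMap id_functor X) (OMap (G \<circ>\<^sub>F F) X)" if "X \<in> Obj C" for X
      using u[OF that] by (simp add: comp_functor_def id_functor_def G_def)
    show "iso C (u X)" if "X \<in> Obj C" for X
      using fully_faithful_conservative[OF assms(1-3)] u[OF that] that
      by (auto simp: is_conservative_def Hom_def)
    fix X Y f assume f: "f \<in> Hom C X Y"
    have o: "X \<in> Obj C" "Y \<in> Obj C" using F.source.Hom_Obj[OF f] by auto
    note Ff = a[OF F.AMap_closed[OF f]]
    have ar: "f \<in> Arr C" "Dom C f = X" "Cod C f = Y"
      "a (AMap F f) \<in> Arr C" "Dom C (a (AMap F f)) = g (OMap F X)" "Cod C (a (AMap F f)) = g (OMap F Y)"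
      "u X \<in> Arr C" "Dom C (u X) = X" "Cod C (u X) = g (OMap F X)"
      "u Y \<in> Arr C" "Dom C (u Y) = Y" "Cod C (u Y) = g (OMap F Y)"
      using f Ff u o by (auto simp: Hom_def)
    have "AMap F (Comp C (a (AMap F f)) (u X)) = AMap F (Comp C (u Y) f)"
      using Ff u o ar by (simp add: F.AMap_Comp_simp conj_def)
    from faithfulD[OF assms(2) this, of X "g (OMap F Y)"]
    show "Comp C (AMap (G \<circ>\<^sub>F F) f) (u X) = Comp C (u Y) (AMap id_functor f)"
      using ar by (simp add: comp_functor_def id_functor_def G_def Hom_def)
  qed
  show ?thesis unfolding is_equivalence_def using assms(1) G \<epsilon> \<eta> by blast
qed

text \<open>Replaces the existence of a strict inverse by conditions on \<open>F\<close> alone,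
  which are the ones that can be verified for a lifted functor.\<close>

lemma is_cat_isomorphism_iff:
  "is_cat_isomorphism C D F \<longleftrightarrow>
     cat_functor C D F \<and> faithful C D F \<and> full C D F \<and> bij_betw (OMap F) (Obj C) (Obj D)"
  (is "?l \<longleftrightarrow> ?r")
proof
  assume ?l
  then obtain G where F: "cat_functor C D F" and G: "cat_functor D C G"
    and GF: "functor_eq C C (G \<circ>\<^sub>F F) id_functor" and FG: "functor_eq D D (F \<circ>\<^sub>F G) id_functor"
    unfolding is_cat_isomorphism_def by blast
  interpret F: cat_functor C D F by fact
  interpret G: cat_functor D C G by fact
  have gf: "OMap G (OMap F X) = X" if "X \<in> Obj C" for X
    using GF that by (simp add: functor_eq_def comp_functor_def id_functor_def)
  have fg: "OMap F (OMap G X) = X" if "X \<in> Obj D" for X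
    using FG that by (simp add: functor_eq_def comp_functor_def id_functor_def)
  have gfa: "AMap G (AMap F f) = f" if "f \<in> Arr C" for f
    using GF that by (simp add: functor_eq_def comp_functor_def id_functor_def)
  have fga: "AMap F (AMap G f) = f" if "f \<in> Arr D" for f
    using FG that by (simp add: functor_eq_def comp_functor_def id_functor_def)
  have "faithful C D F"
    unfolding faithful_def
  proof (intro allI ballI impI)
    fix X Y f g assume "f \<in> Hom C X Y" "g \<in> Hom C X Y" and eq: "AMap F f = AMap F g"
    then have "f \<in> Arr C" "g \<in> Arr C" by (simp_all add: Hom_def)
    then show "f = g" using gfa[of f] gfa[of g] unfolding eq by simp
  qed
  moreover have "full C D F"
    unfolding full_def
  proof (intro ballI)
    fix X Y h assume o: "X \<in> Obj C" "Y \<in> Obj C" and h: "h \<in> Hom D (OMap F X) (OMap F Y)"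
    have "AMap G h \<in> Hom C X Y" using G.AMap_closed[OF h] o gf by simp
    moreover have "AMap F (AMap G h) = h" using h fga by (simp add: Hom_def)
    ultimately show "\<exists>f\<in>Hom C X Y. AMap F f = h" by blast
  qed
  moreover have "bij_betw (OMap F) (Obj C) (Obj D)"
    by (rule bij_betw_byWitness[of _ "OMap G"]) (auto simp: gf fg G.OMap_closed)
  ultimately show ?r using F by blast
next
  assume r: ?r
  then have F: "cat_functor C D F" and ff: "faithful C D F" "full C D F"
    and bij: "bij_betw (OMap F) (Obj C) (Obj D)" by auto
  interpret F: cat_functor C D F by fact
  define g where "g = inv_into (Obj C) (OMap F)"
  have g [simp]: "g X \<in> Obj C" "OMap F (g X) = X" if "X \<in> Obj D" for X
    using bij that by (auto simp: g_def bij_betw_def inv_into_into f_inv_into_f)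
  have gF: "g (OMap F X) = X" if "X \<in> Obj C" for X
    using bij that by (simp add: g_def bij_betw_def)
  \<comment> \<open>Since \<open>F (g Y) = Y\<close> exactly, \<open>h\<close> itself is lifted
    without conjugation; this is why the inverse is strict.\<close>
  define a where "a h = (SOME f. f \<in> Hom C (g (Dom D h)) (g (Cod D h)) \<and> AMap F f = h)" for h
  have a: "a h \<in> Hom C (g Y) (g Z) \<and> AMap F (a h) = h" if h: "h \<in> Hom D Y Z" for h Y Z
  proof -
    have o: "Y \<in> Obj D" "Z \<in> Obj D" using F.target.Hom_Obj[OF h] by auto
    then have "h \<in> Hom D (OMap F (g Y)) (OMap F (g Z))" using h by simp
    then obtain f where "f \<in> Hom C (g Y) (g Z)" "AMap F f = h"
      using fullE[OF ff(2) g(1)[OF o(1)] g(1)[OF o(2)]] by blast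
    then have "\<exists>f. f \<in> Hom C (g (Dom D h)) (g (Cod D h)) \<and> AMap F f = h"
      using h by (auto simp: Hom_def)
    from someI_ex[OF this] show ?thesis using h by (auto simp: a_def Hom_def)
  qed
  define G where "G = \<lparr>OMap = g, AMap = a\<rparr>"
  have G: "cat_functor D C G"
  proof
    show "OMap G X \<in> Obj C" if "X \<in> Obj D" for X using that by (simp add: G_def)
    show "AMap G f \<in> Hom C (OMap G X) (OMap G Y)" if "f \<in> Hom D X Y" for f X Y
      using a[OF that] by (simp add: G_def)
    show "AMap G (Idt D X) = Idt C (OMap G X)" if X: "X \<in> Obj D" for X
    proof -
      note i = a[OF F.target.Idt_closed[OF X]]
      have "AMap F (a (Idt D X)) = AMap F (Idt C (g X))" using i X by (simp add: F.AMap_Idt)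
      from faithfulD[OF ff(1) this conjunct1[OF i] F.source.Idt_closed] X
      show ?thesis by (simp add: G_def)
    qed
    show "AMap G (Comp D k h) = Comp C (AMap G k) (AMap G h)"
      if h: "h \<in> Hom D X Y" and k: "k \<in> Hom D Y Z" for h k X Y Z
    proof -
      note kh = F.target.Comp_closed[OF h k]
      have "AMap F (a (Comp D k h)) = AMap F (Comp C (a k) (a h))"
        using a[OF h] a[OF k] a[OF kh]
        by (simp add: F.AMap_Comp[OF conjunct1[OF a[OF h]] conjunct1[OF a[OF k]]])
      from faithfulD[OF ff(1) this conjunct1[OF a[OF kh]]
          F.source.Comp_closed[OF conjunct1[OF a[OF h]] conjunct1[OF a[OF k]]]]
      show ?thesis by (simp add: G_def)
    qed
  qed
  have "AMap G (AMap F f) = f" if f: "f \<in> Arr C" for f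
  proof -
    have f': "f \<in> Hom C (Dom C f) (Cod C f)" using f by (simp add: Hom_def)
    note i = a[OF F.AMap_closed[OF f']]
    have "a (AMap F f) \<in> Hom C (Dom C f) (Cod C f)"
      using i f by (simp add: gF F.source.Dom_closed F.source.Cod_closed)
    from faithfulD[OF ff(1) conjunct2[OF i] this f'] show ?thesis by (simp add: G_def)
  qed
  then have "functor_eq C C (G \<circ>\<^sub>F F) id_functor"
    using cat_functor_comp[OF F G] cat_functor_id[OF F.source.category_axioms]
    by (simp add: functor_eq_def comp_functor_def id_functor_def G_def gF)
  moreover have "AMap F (a f) = f" if "f \<in> Arr D" for f
    using a[of f "Dom D f" "Cod D f"] that by (simp add: Hom_def)
  then have "functor_eq D D (F \<circ>\<^sub>F G) id_functor"
    using cat_functor_comp[OF G F] cat_functor_id[OF F.target.category_axioms]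
    by (simp add: functor_eq_def comp_functor_def id_functor_def G_def)
  ultimately show ?l unfolding is_cat_isomorphism_def using F G by blast
qed

section \<open>Functors between categories of structured objects\<close>

lemma structured_cat_simps [simp]:
  "Obj (structured_cat M S U P) = S"
  "Idt (structured_cat M S U P) X = (X, Idt M (U X), X)"
  "Comp (structured_cat M S U P) (X', g, Z) (X, f, Y) = (X, Comp M g f, Z)"
  "Dom (structured_cat M S U P) (X, f, Y) = X"
  "Cod (structured_cat M S U P) (X, f, Y) = Y"
  "(X, f, Y) \<in> Arr (structured_cat M S U P) \<longleftrightarrow>
     X \<in> S \<and> Y \<in> S \<and> f \<in> Hom M (U X) (U Y) \<and> P X Y f"
  by (simp_all add: structured_cat_def)

lemma Hom_structured_cat:
  "h \<in> Hom (structured_cat M S U P) X Y \<longleftrightarrow>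
     X \<in> S \<and> Y \<in> S \<and> (\<exists>f \<in> Hom M (U X) (U Y). P X Y f \<and> h = (X, f, Y))"
  by (cases h) (auto simp: Hom_def[of "structured_cat M S U P"])

text \<open>The conditions have to agree only on well-typed data. This matters for units and
  counits, where the uniform square contains an extra identity of \<one> that disappears only for
  typed arrows.\<close>

lemma structured_cat_cong:
  assumes "S = S'"
    and "\<And>X Y f. X \<in> S' \<Longrightarrow> Y \<in> S' \<Longrightarrow> f \<in> Hom M (U X) (U Y) \<Longrightarrow> P X Y f = P' X Y f"
  shows "structured_cat M S U P = structured_cat M S' U P'"
  using assms unfolding structured_cat_def by auto

text \<open>\<open>P_Idt\<close> and \<open>P_Comp\<close> make the structured objects a category;
  \<open>P_Inv\<close> is what makes forgetting the structure conservative.\<close>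

locale structured_category = category M
  for M :: "('o, 'a, 'z) cat_scheme" (structure) +
  fixes S :: "'s set" and U :: "'s \<Rightarrow> 'o" and P :: "'s \<Rightarrow> 's \<Rightarrow> 'a \<Rightarrow> bool"
  assumes U_closed: "X \<in> S \<Longrightarrow> U X \<in> Obj M"
    and P_Idt: "X \<in> S \<Longrightarrow> P X X (\<i> (U X))"
    and P_Comp: "X \<in> S \<Longrightarrow> Y \<in> S \<Longrightarrow> Z \<in> S \<Longrightarrow> f \<in> Hom M (U X) (U Y) \<Longrightarrow> g \<in> Hom M (U Y) (U Z) \<Longrightarrow>
      P X Y f \<Longrightarrow> P Y Z g \<Longrightarrow> P X Z (g \<cdot> f)"
    and P_Inv: "X \<in> S \<Longrightarrow> Y \<in> S \<Longrightarrow> f \<in> Hom M (U X) (U Y) \<Longrightarrow> iso M f \<Longrightarrow>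
      P X Y f \<Longrightarrow> P Y X (Inv M f)"
begin

abbreviation "str \<equiv> structured_cat M S U P"

sublocale str: category str
proof
  fix f g h W X Y Z
  show "Dom str f \<in> Obj str" "Cod str f \<in> Obj str" if "f \<in> Arr str"
    using that by (cases f; simp)+
  show "Idt str X \<in> Hom str X X" if "X \<in> Obj str"
    using that by (simp add: Hom_structured_cat U_closed Idt_closed P_Idt)
  show "Comp str g f \<in> Hom str X Z" if "f \<in> Hom str X Y" "g \<in> Hom str Y Z"
    using that P_Comp Comp_closed by (fastforce simp: Hom_structured_cat)
  show "Comp str (Idt str Y) f = f" "Comp str f (Idt str X) = f" if "f \<in> Hom str X Y"
    using that Idt_left Idt_right by (auto simp: Hom_structured_cat)
  show "Comp str (Comp str h g) f = Comp str h (Comp str g f)"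
    if "f \<in> Hom str W X" "g \<in> Hom str X Y" "h \<in> Hom str Y Z"
    using that by (auto simp: Hom_structured_cat Hom_def[of M])
qed

text \<open>An inverse of structured morphisms has an underlying inverse, and conversely
  \<open>P_Inv\<close> makes the inverse of \<open>f\<close> a structured morphism.\<close>

lemma iso_str_iff:
  assumes "(X, f, Y) \<in> Arr str" shows "iso str (X, f, Y) \<longleftrightarrow> iso M f"
proof
  have f: "f \<in> Hom M (U X) (U Y)" "X \<in> S" "Y \<in> S" "P X Y f" using assms by auto
  show "iso M f" if i: "iso str (X, f, Y)"
  proof -
    obtain h where "inverse_arrows str (X, f, Y) h" using i unfolding iso_def by blast
    then obtain g where "g \<in> Hom M (U Y) (U X)" "g \<cdot> f = \<i> (U X)" "f \<cdot> g = \<i> (U Y)"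
      by (auto simp: inverse_arrows_def Hom_structured_cat)
    with f(1) show ?thesis by (rule isoI)
  qed
  show "iso str (X, f, Y)" if "iso M f"
  proof (rule str.isoI)
    show "(X, f, Y) \<in> Hom str X Y" "(Y, Inv M f, X) \<in> Hom str Y X"
      using f that Inv_closed P_Inv by (auto simp: Hom_structured_cat)
    have "Dom M f = U X" "Cod M f = U Y" using f by (auto simp: Hom_def)
    then show "Comp str (Y, Inv M f, X) (X, f, Y) = Idt str X"
      "Comp str (X, f, Y) (Y, Inv M f, X) = Idt str Y"
      using that by auto
  qed
qed

lemma cat_functor_underlying: "cat_functor str M (underlying_functor U)"
  by unfold_locales (auto simp: underlying_functor_def Hom_structured_cat U_closed)

lemma is_conservative_underlying: "is_conservative str M (underlying_functor U)"
  unfolding is_conservative_def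
  using cat_functor_underlying iso_str_iff by (auto simp: underlying_functor_def)

end

text \<open>Two uses: with \<open>F\<close> the identity functor and \<open>T\<close> dropping
  components it describes the forgetful functors between structured categories, and with
  \<open>F\<close> monoidal the induced functors.\<close>

locale structured_lift =
  S: structured_category M S U P + S': structured_category M' S' U' P' + cat_functor M M' F
  for M :: "('o, 'a, 'y) cat_scheme" and S :: "'s set" and U P
    and M' :: "('p, 'b, 'z) cat_scheme" and S' :: "'t set" and U' P'
    and F :: "('o, 'a, 'p, 'b) fctr" +
  fixes T :: "'s \<Rightarrow> 't"
  assumes T_closed: "X \<in> S \<Longrightarrow> T X \<in> S'"
    and U_T: "X \<in> S \<Longrightarrow> U' (T X) = OMap F (U X)"
    and P_T: "X \<in> S \<Longrightarrow> Y \<in> S \<Longrightarrow> f \<in> Hom M (U X) (U Y) \<Longrightarrow> P X Y f \<Longrightarrow>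
      P' (T X) (T Y) (AMap F f)"
begin

abbreviation "lift \<equiv> structured_functor T (AMap F)"

lemma cat_functor_lift: "cat_functor S.str S'.str lift"
  by unfold_locales
    (auto simp: structured_functor_def Hom_structured_cat T_closed U_T P_T AMap_closed AMap_Idt
      AMap_Comp S.U_closed)

text \<open>In both structured categories, being an isomorphism depends on the underlying arrow
  only, so the property of \<open>F\<close> carries over.\<close>

lemma is_conservative_lift:
  assumes "is_conservative M M' F" shows "is_conservative S.str S'.str lift"
  unfolding is_conservative_def
proof (intro conjI ballI impI cat_functor_lift)
  fix h assume h: "h \<in> Arr S.str" and iso: "iso S'.str (AMap lift h)"
  obtain X f Y where [simp]: "h = (X, f, Y)" by (cases h)
  have "(T X, AMap F f, T Y) \<in> Arr S'.str" using h T_closed P_T U_T AMap_closed by auto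
  then have "iso M' (AMap F f)" using iso S'.iso_str_iff by (simp add: structured_functor_def)
  then have "iso M f" using assms h by (auto simp: is_conservative_def Hom_def)
  then show "iso S.str h" using S.iso_str_iff h by simp
qed

lemma faithful_lift:
  assumes "faithful M M' F" shows "faithful S.str S'.str lift"
  unfolding faithful_def
proof (intro allI ballI impI)
  fix X Y h k assume "h \<in> Hom S.str X Y" "k \<in> Hom S.str X Y" "AMap lift h = AMap lift k"
  then obtain f g where "h = (X, f, Y)" "k = (X, g, Y)" "f \<in> Hom M (U X) (U Y)"
    "g \<in> Hom M (U X) (U Y)" "AMap F f = AMap F g"
    by (auto simp: Hom_structured_cat structured_functor_def)
  then show "h = k" using faithfulD[OF assms] by blast
qed

lemma full_lift:
  assumes "full M M' F"
    and "\<And>X Y f. X \<in> S \<Longrightarrow> Y \<in> S \<Longrightarrow> f \<in> Hom M (U X) (U Y) \<Longrightarrow> P' (T X) (T Y) (AMap F f) \<Longrightarrow> P X Y f"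
  shows "full S.str S'.str lift"
  unfolding full_def
proof (intro ballI)
  fix X Y h assume "X \<in> Obj S.str" "Y \<in> Obj S.str"
    and "h \<in> Hom S'.str (OMap lift X) (OMap lift Y)"
  then obtain f' where o: "X \<in> S" "Y \<in> S" and f': "f' \<in> Hom M' (OMap F (U X)) (OMap F (U Y))"
    "P' (T X) (T Y) f'" "h = (T X, f', T Y)"
    by (auto simp: Hom_structured_cat structured_functor_def U_T)
  obtain f where f: "f \<in> Hom M (U X) (U Y)" "AMap F f = f'"
    using fullE[OF assms(1) S.U_closed[OF o(1)] S.U_closed[OF o(2)] f'(1)] .
  have "(X, f, Y) \<in> Hom S.str X Y"
    using f f' o assms(2)[OF o f(1)] by (auto simp: Hom_structured_cat)
  moreover have "AMap lift (X, f, Y) = h" using f f' by (simp add: structured_functor_def)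
  ultimately show "\<exists>f\<in>Hom S.str X Y. AMap lift f = h" by blast
qed

end

text \<open>\<open>transport\<close> pulls a structure over \<open>FA\<close>, up to \<theta>, back
  to \<open>A\<close>. \<open>amnestic\<close> and \<open>amnestic'\<close> express that the
  structure on a fixed object is detected by whether its identity is a morphism.\<close>

locale transportable_lift = structured_lift +
  assumes P_reflect: "faithful M M' F \<Longrightarrow> X \<in> S \<Longrightarrow> Y \<in> S \<Longrightarrow> f \<in> Hom M (U X) (U Y) \<Longrightarrow>
      P' (T X) (T Y) (AMap F f) \<Longrightarrow> P X Y f"
    and transport: "faithful M M' F \<Longrightarrow> full M M' F \<Longrightarrow> X' \<in> S' \<Longrightarrow> A \<in> Obj M \<Longrightarrow>
      \<theta> \<in> Hom M' (U' X') (OMap F A) \<Longrightarrow> iso M' \<theta> \<Longrightarrow> \<exists>X \<in> S. U X = A \<and> P' X' (T X) \<theta>"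
    and amnestic: "X \<in> S \<Longrightarrow> Y \<in> S \<Longrightarrow> U X = U Y \<Longrightarrow> P X Y (Idt M (U X)) \<Longrightarrow> X = Y"
    and amnestic': "X' \<in> S' \<Longrightarrow> Y' \<in> S' \<Longrightarrow> U' X' = U' Y' \<Longrightarrow> P' X' Y' (Idt M' (U' X')) \<Longrightarrow> X' = Y'"
begin

lemma is_equivalence_lift:
  assumes "is_equivalence M M' F" shows "is_equivalence S.str S'.str lift"
proof (rule is_equivalenceI)
  note ff = is_equivalence_faithful[OF assms] is_equivalence_full[OF assms]
  show "cat_functor S.str S'.str lift" by (rule cat_functor_lift)
  show "faithful S.str S'.str lift" by (rule faithful_lift[OF ff(1)])
  show "full S.str S'.str lift" by (rule full_lift[OF ff(2) P_reflect[OF ff(1)]])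
  show "essentially_surjective S.str S'.str lift"
    unfolding essentially_surjective_def
  proof
    fix Y assume "Y \<in> Obj S'.str"
    then have Y: "Y \<in> S'" by simp
    obtain A e where A: "A \<in> Obj M" and e: "e \<in> Hom M' (OMap F A) (U' Y)" "iso M' e"
      using is_equivalence_essentially_surjective[OF assms] S'.U_closed[OF Y]
      unfolding essentially_surjective_def by blast
    \<comment> \<open>Essential surjectivity gives \<open>e\<close> pointing towards
      \<open>U' Y\<close>, whereas \<open>transport\<close> expects an isomorphism starting there;
      hence the inverse as \<theta>.\<close>
    obtain X where X: "X \<in> S" "U X = A" "P' Y (T X) (Inv M' e)"
      using transport[OF ff Y A S'.Inv_closed[OF e(2,1)] S'.iso_Inv[OF e(2)]] by blast
    have t: "(Y, Inv M' e, T X) \<in> Arr S'.str"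
      using X Y T_closed[OF X(1)] U_T[OF X(1)] S'.Inv_closed[OF e(2,1)] by simp
    then have i: "iso S'.str (Y, Inv M' e, T X)"
      using S'.iso_str_iff S'.iso_Inv[OF e(2)] by simp
    have "Inv S'.str (Y, Inv M' e, T X) \<in> Hom S'.str (OMap lift X) Y"
      by (rule S'.str.Inv_closed[OF i]) (use t in \<open>simp add: Hom_def structured_functor_def\<close>)
    then show "\<exists>X\<in>Obj S.str. \<exists>e\<in>Hom S'.str (OMap lift X) Y. iso S'.str e"
      using S'.str.iso_Inv[OF i] X(1) by auto
  qed
qed

text \<open>Only bijectivity of \<open>T\<close> is new. Injectivity comes from reflecting an
  identity morphism, surjectivity from transporting along one; amnesticity turns both into
  equalities.\<close>

lemma is_cat_isomorphism_lift:
  assumes "is_cat_isomorphism M M' F" shows "is_cat_isomorphism S.str S'.str lift"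
proof -
  have ff: "faithful M M' F" "full M M' F" and bij: "bij_betw (OMap F) (Obj M) (Obj M')"
    using assms by (simp_all add: is_cat_isomorphism_iff)
  have "bij_betw T S S'"
    unfolding bij_betw_def
  proof
    show "inj_on T S"
    proof (rule inj_onI)
      fix X Y assume o: "X \<in> S" "Y \<in> S" and eq: "T X = T Y"
      have "OMap F (U X) = OMap F (U Y)" using U_T[OF o(1)] U_T[OF o(2)] eq by simp
      then have U: "U X = U Y"
        using bij S.U_closed o by (auto simp: bij_betw_def dest: inj_onD)
      \<comment> \<open>Because \<open>T X = T Y\<close>, this identity is also a morphism from
        \<open>T X\<close> to \<open>T Y\<close>, and it is the image under \<open>F\<close> of the
        identity of \<open>U X\<close>.\<close>
      have "P' (T X) (T X) (Idt M' (U' (T X)))" by (rule S'.P_Idt[OF T_closed[OF o(1)]])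
      then have "P' (T X) (T Y) (AMap F (Idt M (U X)))"
        using o by (simp add: eq[symmetric] U_T AMap_Idt S.U_closed)
      then have "P X Y (Idt M (U X))"
        using P_reflect[OF ff(1) o] U S.Idt_closed[OF S.U_closed[OF o(1)]] by simp
      then show "X = Y" by (rule amnestic[OF o U])
    qed
    have "\<exists>X \<in> S. T X = Y" if Y: "Y \<in> S'" for Y
    proof -
      obtain A where A: "A \<in> Obj M" "OMap F A = U' Y"
        using bij S'.U_closed[OF Y] unfolding bij_betw_def by (metis imageE)
      \<comment> \<open>Here \<open>FA\<close> equals \<open>U' Y\<close>, so \<theta> may be taken
        to be the identity.\<close>
      obtain X where X: "X \<in> S" "U X = A" "P' Y (T X) (Idt M' (U' Y))"
        using transport[OF ff Y A(1), of "Idt M' (U' Y)"] A(2) S'.U_closed[OF Y]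
          S'.Idt_closed S'.iso_Idt by auto
      then have "Y = T X" using U_T[OF X(1)] A(2) by (intro amnestic' Y T_closed) auto
      with X(1) show ?thesis by blast
    qed
    then show "T ` S = S'" using T_closed by auto
  qed
  then show ?thesis
    unfolding is_cat_isomorphism_iff
    using cat_functor_lift faithful_lift[OF ff(1)] full_lift[OF ff(2) P_reflect[OF ff(1)]]
    by (simp add: structured_functor_def)
qed

end

section \<open>Monoidal functors\<close>

context monoidal_category
begin

lemma TensO_simp [simp]: "X \<in> Obj M \<Longrightarrow> Y \<in> Obj M \<Longrightarrow> X \<otimes>\<^sub>o Y \<in> Obj M"
  by (rule TensO_closed)

lemma Unit_simp [simp]: "\<one> \<in> Obj M"
  by (rule Unit_closed)

lemma Tens_simps [simp]:
  assumes "f \<in> Arr M" "g \<in> Arr M"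
  shows "f \<otimes> g \<in> Arr M" "Dom M (f \<otimes> g) = Dom M f \<otimes>\<^sub>o Dom M g"
    "Cod M (f \<otimes> g) = Cod M f \<otimes>\<^sub>o Cod M g"
  using TensA_closed[of f "Dom M f" "Cod M f" g "Dom M g" "Cod M g"] assms by (auto simp: Hom_def)

lemma structure_simps [simp]:
  assumes "X \<in> Obj M"
  shows "\<l> X \<in> Arr M" "Dom M (\<l> X) = \<one> \<otimes>\<^sub>o X" "Cod M (\<l> X) = X" "iso M (\<l> X)"
    "\<r> X \<in> Arr M" "Dom M (\<r> X) = X \<otimes>\<^sub>o \<one>" "Cod M (\<r> X) = X" "iso M (\<r> X)"
  using LUnit_closed[OF assms] RUnit_closed[OF assms] LUnit_iso[OF assms] RUnit_iso[OF assms]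
  by (auto simp: Hom_def)

lemma Assoc_simps [simp]:
  assumes "X \<in> Obj M" "Y \<in> Obj M" "Z \<in> Obj M"
  shows "\<a> X Y Z \<in> Arr M" "Dom M (\<a> X Y Z) = (X \<otimes>\<^sub>o Y) \<otimes>\<^sub>o Z"
    "Cod M (\<a> X Y Z) = X \<otimes>\<^sub>o (Y \<otimes>\<^sub>o Z)" "iso M (\<a> X Y Z)"
  using Assoc_closed[OF assms] Assoc_iso[OF assms] by (auto simp: Hom_def)

lemma interchange:
  "f \<in> Arr M \<Longrightarrow> g \<in> Arr M \<Longrightarrow> f' \<in> Arr M \<Longrightarrow> g' \<in> Arr M \<Longrightarrow>
   Dom M g = Cod M f \<Longrightarrow> Dom M g' = Cod M f' \<Longrightarrow>
   (g \<otimes> g') \<cdot> (f \<otimes> f') = (g \<cdot> f) \<otimes> (g' \<cdot> f')"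
  by (rule Tens_Comp[symmetric, of f "Dom M f" "Cod M f" g "Cod M g" f' "Dom M f'" "Cod M f'" g' "Cod M g'"])
    (simp_all add: Hom_def)

lemma iso_Tens [simp]:
  assumes "iso M f" "iso M g" shows "iso M (f \<otimes> g)"
  by (rule isoI[of _ "Dom M f \<otimes>\<^sub>o Dom M g" "Cod M f \<otimes>\<^sub>o Cod M g" "Inv M f \<otimes> Inv M g"])
    (use assms in \<open>simp_all add: Hom_def iso_Arr interchange Tens_Idt Dom_closed Cod_closed\<close>)

end

context monoidal_functor
begin

lemma phi_simps [simp]:
  "\<phi>0 \<in> Arr M'" "Dom M' \<phi>0 = \<one>" "Cod M' \<phi>0 = OMap F \<one>\<^bsub>M\<^esub>" "iso M' \<phi>0"
  using phi0_closed phi0_iso by (auto simp: Hom_def)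

lemma phi2_simps [simp]:
  assumes "U \<in> Obj M" "V \<in> Obj M"
  shows "\<phi>2 U V \<in> Arr M'" "Dom M' (\<phi>2 U V) = OMap F U \<otimes>\<^sub>o OMap F V"
    "Cod M' (\<phi>2 U V) = OMap F (U \<otimes>\<^sub>o\<^bsub>M\<^esub> V)" "iso M' (\<phi>2 U V)"
  using phi2_closed[OF assms] phi2_iso[OF assms] by (auto simp: Hom_def)

text \<open>Naturality of \<open>\<phi>2\<close> precomposed with \<open>x \<otimes> y\<close>, the
  shape in which it meets the recursive \<open>comparison\<close> maps.\<close>

lemma phi2_naturality:
  assumes f: "f \<in> Hom M U U'" and g: "g \<in> Hom M V V'"
    and x: "x \<in> Hom M' A (OMap F U)" and y: "y \<in> Hom M' B (OMap F V)"
  shows "\<phi>2 U' V' \<cdot> ((AMap F f \<cdot> x) \<otimes> (AMap F g \<cdot> y)) = AMap F (f \<otimes>\<^bsub>M\<^esub> g) \<cdot> \<phi>2 U V \<cdot> (x \<otimes> y)"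
proof -
  have o: "U \<in> Obj M" "V \<in> Obj M" "U' \<in> Obj M" "V' \<in> Obj M"
    using source.Hom_Obj[OF f] source.Hom_Obj[OF g] by auto
  note ar = f[unfolded Hom_def, simplified] g[unfolded Hom_def, simplified]
    x[unfolded Hom_def, simplified] y[unfolded Hom_def, simplified]
  have "\<phi>2 U' V' \<cdot> ((AMap F f \<cdot> x) \<otimes> (AMap F g \<cdot> y)) =
      (\<phi>2 U' V' \<cdot> (AMap F f \<otimes> AMap F g)) \<cdot> (x \<otimes> y)"
    using ar o by (simp add: target.interchange)
  also have "\<dots> = AMap F (f \<otimes>\<^bsub>M\<^esub> g) \<cdot> \<phi>2 U V \<cdot> (x \<otimes> y)"
    unfolding phi2_natural[OF f g] using ar o by simp
  finally show ?thesis .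
qed

text \<open>Naturality moves the target associator past \<open>x\<close>, \<open>y\<close>,
  \<open>z\<close> to the objects \<open>FU\<close>, \<open>FV\<close>, \<open>FW\<close>, where the
  hexagon for \<open>\<phi>2\<close> applies. With comparison maps for \<open>x\<close>,
  \<open>y\<close>, \<open>z\<close>, both sides contain comparison maps of triple tensors.\<close>

lemma phi2_associativity:
  assumes o: "U \<in> Obj M" "V \<in> Obj M" "W \<in> Obj M"
    and x: "x \<in> Hom M' A (OMap F U)" and y: "y \<in> Hom M' B (OMap F V)"
    and z: "z \<in> Hom M' C (OMap F W)"
  shows "(\<phi>2 U (V \<otimes>\<^sub>o\<^bsub>M\<^esub> W) \<cdot> (x \<otimes> (\<phi>2 V W \<cdot> (y \<otimes> z)))) \<cdot> \<a> A B C =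
    AMap F (\<a>\<^bsub>M\<^esub> U V W) \<cdot> \<phi>2 (U \<otimes>\<^sub>o\<^bsub>M\<^esub> V) W \<cdot> ((\<phi>2 U V \<cdot> (x \<otimes> y)) \<otimes> z)"
proof -
  have o': "A \<in> Obj M'" "B \<in> Obj M'" "C \<in> Obj M'"
    using target.Hom_Obj[OF x] target.Hom_Obj[OF y] target.Hom_Obj[OF z] by auto
  note ar = x[unfolded Hom_def, simplified] y[unfolded Hom_def, simplified]
    z[unfolded Hom_def, simplified] o o'
  let ?\<phi> = "\<phi>2 U (V \<otimes>\<^sub>o\<^bsub>M\<^esub> W)"
  have "(?\<phi> \<cdot> (x \<otimes> (\<phi>2 V W \<cdot> (y \<otimes> z)))) \<cdot> \<a> A B C =
      (?\<phi> \<cdot> ((\<i> (OMap F U) \<otimes> \<phi>2 V W) \<cdot> (x \<otimes> (y \<otimes> z)))) \<cdot> \<a> A B C"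
    using ar by (simp add: target.interchange)
  also have "\<dots> = ?\<phi> \<cdot> (\<i> (OMap F U) \<otimes> \<phi>2 V W) \<cdot> (x \<otimes> (y \<otimes> z)) \<cdot> \<a> A B C"
    using ar by simp
  also have "\<dots> = ?\<phi> \<cdot> (\<i> (OMap F U) \<otimes> \<phi>2 V W) \<cdot>
      \<a> (OMap F U) (OMap F V) (OMap F W) \<cdot> ((x \<otimes> y) \<otimes> z)"
    unfolding target.Assoc_natural[OF x y z] ..
  also have "\<dots> = (?\<phi> \<cdot> (\<i> (OMap F U) \<otimes> \<phi>2 V W) \<cdot> \<a> (OMap F U) (OMap F V) (OMap F W)) \<cdot>
      ((x \<otimes> y) \<otimes> z)"
    using ar by simp
  also have "\<dots> = AMap F (\<a>\<^bsub>M\<^esub> U V W) \<cdot> \<phi>2 (U \<otimes>\<^sub>o\<^bsub>M\<^esub> V) W \<cdot>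
      (\<phi>2 U V \<otimes> \<i> (OMap F W)) \<cdot> ((x \<otimes> y) \<otimes> z)"
    unfolding phi2_assoc[OF o] using ar by simp
  also have "\<dots> = AMap F (\<a>\<^bsub>M\<^esub> U V W) \<cdot> \<phi>2 (U \<otimes>\<^sub>o\<^bsub>M\<^esub> V) W \<cdot> ((\<phi>2 U V \<cdot> (x \<otimes> y)) \<otimes> z)"
    using ar by (simp add: target.interchange)
  finally show ?thesis .
qed

text \<open>Naturality of the left unit constraint reduces the claim to the unit coherence at
  \<open>FU\<close>.\<close>

lemma phi_left_unit:
  assumes o: "U \<in> Obj M" and x: "x \<in> Hom M' A (OMap F U)"
  shows "x \<cdot> \<l> A = AMap F (\<l>\<^bsub>M\<^esub> U) \<cdot> \<phi>2 \<one>\<^bsub>M\<^esub> U \<cdot> (\<phi>0 \<otimes> x)"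
proof -
  have o': "A \<in> Obj M'" using target.Hom_Obj[OF x] by auto
  note ar = x[unfolded Hom_def, simplified] o o'
  have "x \<cdot> \<l> A = \<l> (OMap F U) \<cdot> (\<i> \<one> \<otimes> x)" by (rule target.LUnit_natural[OF x, symmetric])
  also have "\<dots> = AMap F (\<l>\<^bsub>M\<^esub> U) \<cdot> \<phi>2 \<one>\<^bsub>M\<^esub> U \<cdot> (\<phi>0 \<otimes> \<i> (OMap F U)) \<cdot> (\<i> \<one> \<otimes> x)"
    unfolding phi_LUnit[OF o, symmetric] using ar by simp
  also have "\<dots> = AMap F (\<l>\<^bsub>M\<^esub> U) \<cdot> \<phi>2 \<one>\<^bsub>M\<^esub> U \<cdot> (\<phi>0 \<otimes> x)"
    using ar by (simp add: target.interchange)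
  finally show ?thesis .
qed

lemma phi_right_unit:
  assumes o: "U \<in> Obj M" and x: "x \<in> Hom M' A (OMap F U)"
  shows "x \<cdot> \<r> A = AMap F (\<r>\<^bsub>M\<^esub> U) \<cdot> \<phi>2 U \<one>\<^bsub>M\<^esub> \<cdot> (x \<otimes> \<phi>0)"
proof -
  have o': "A \<in> Obj M'" using target.Hom_Obj[OF x] by auto
  note ar = x[unfolded Hom_def, simplified] o o'
  have "x \<cdot> \<r> A = \<r> (OMap F U) \<cdot> (x \<otimes> \<i> \<one>)" by (rule target.RUnit_natural[OF x, symmetric])
  also have "\<dots> = AMap F (\<r>\<^bsub>M\<^esub> U) \<cdot> \<phi>2 U \<one>\<^bsub>M\<^esub> \<cdot> (\<i> (OMap F U) \<otimes> \<phi>0) \<cdot> (x \<otimes> \<i> \<one>)"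
    unfolding phi_RUnit[OF o, symmetric] using ar by simp
  also have "\<dots> = AMap F (\<r>\<^bsub>M\<^esub> U) \<cdot> \<phi>2 U \<one>\<^bsub>M\<^esub> \<cdot> (x \<otimes> \<phi>0)"
    using ar by (simp add: target.interchange)
  finally show ?thesis .
qed

end

section \<open>Formal tensor expressions and their interpretation\<close>

text \<open>\<open>tobj\<close> are the tensor expressions in one object variable, \<open>gen\<close> the names of the structure maps
  \<open>m, u, \<Delta>, \<epsilon>, c\<close>, and \<open>tm\<close> the formal morphisms; the suffix \<open>I\<close> marks inverse constraints. A kind of
  structure is given by the set \<open>\<Sigma>\<close> of the structure maps it has and a set \<open>E\<close> of equations; values of
  an assignment \<open>gen \<Rightarrow> 'a\<close> outside \<open>\<Sigma>\<close> are irrelevant.\<close>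

datatype tobj = Var | One | Tensor tobj tobj

primrec obj_interp :: "('o, 'a) moncat \<Rightarrow> 'o \<Rightarrow> tobj \<Rightarrow> 'o" where
  "obj_interp M A Var = A"
| "obj_interp M A One = Unit M"
| "obj_interp M A (Tensor S T) = TensO M (obj_interp M A S) (obj_interp M A T)"

primrec map_interp :: "('o, 'a) moncat \<Rightarrow> 'a \<Rightarrow> tobj \<Rightarrow> 'a" where
  "map_interp M f Var = f"
| "map_interp M f One = Idt M (Unit M)"
| "map_interp M f (Tensor S T) = TensA M (map_interp M f S) (map_interp M f T)"

datatype gen = Mul | Unt | Comul | Counit | Braid

primrec gen_dom :: "gen \<Rightarrow> tobj" where
  "gen_dom Mul = Tensor Var Var" | "gen_dom Unt = One" | "gen_dom Comul = Var" | "gen_dom Counit = Var"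
| "gen_dom Braid = Tensor Var Var"

primrec gen_cod :: "gen \<Rightarrow> tobj" where
  "gen_cod Mul = Var" | "gen_cod Unt = Var" | "gen_cod Comul = Tensor Var Var" | "gen_cod Counit = One"
| "gen_cod Braid = Tensor Var Var"

datatype tm =
    Gen gen | Idn tobj | Cmp tm tm (infixr "\<odot>" 60) | Ten tm tm (infixl "\<boxtimes>" 70)
  | Asc tobj tobj tobj | AscI tobj tobj tobj | LUn tobj | LUnI tobj | RUn tobj | RUnI tobj

primrec tm_dom :: "tm \<Rightarrow> tobj" where
  "tm_dom (Gen g) = gen_dom g"
| "tm_dom (Idn T) = T"
| "tm_dom (s \<odot> t) = tm_dom t"
| "tm_dom (s \<boxtimes> t) = Tensor (tm_dom s) (tm_dom t)"
| "tm_dom (Asc R S T) = Tensor (Tensor R S) T"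
| "tm_dom (AscI R S T) = Tensor R (Tensor S T)"
| "tm_dom (LUn T) = Tensor One T"
| "tm_dom (LUnI T) = T"
| "tm_dom (RUn T) = Tensor T One"
| "tm_dom (RUnI T) = T"

primrec tm_cod :: "tm \<Rightarrow> tobj" where
  "tm_cod (Gen g) = gen_cod g"
| "tm_cod (Idn T) = T"
| "tm_cod (s \<odot> t) = tm_cod s"
| "tm_cod (s \<boxtimes> t) = Tensor (tm_cod s) (tm_cod t)"
| "tm_cod (Asc R S T) = Tensor R (Tensor S T)"
| "tm_cod (AscI R S T) = Tensor (Tensor R S) T"
| "tm_cod (LUn T) = T"
| "tm_cod (LUnI T) = Tensor One T"
| "tm_cod (RUn T) = T"
| "tm_cod (RUnI T) = Tensor T One"

primrec well_typed :: "gen set \<Rightarrow> tm \<Rightarrow> bool" where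
  "well_typed \<Sigma> (Gen g) \<longleftrightarrow> g \<in> \<Sigma>"
| "well_typed \<Sigma> (Idn T) \<longleftrightarrow> True"
| "well_typed \<Sigma> (s \<odot> t) \<longleftrightarrow> well_typed \<Sigma> s \<and> well_typed \<Sigma> t \<and> tm_dom s = tm_cod t"
| "well_typed \<Sigma> (s \<boxtimes> t) \<longleftrightarrow> well_typed \<Sigma> s \<and> well_typed \<Sigma> t"
| "well_typed \<Sigma> (Asc R S T) \<longleftrightarrow> True"
| "well_typed \<Sigma> (AscI R S T) \<longleftrightarrow> True"
| "well_typed \<Sigma> (LUn T) \<longleftrightarrow> True"
| "well_typed \<Sigma> (LUnI T) \<longleftrightarrow> True"
| "well_typed \<Sigma> (RUn T) \<longleftrightarrow> True"
| "well_typed \<Sigma> (RUnI T) \<longleftrightarrow> True"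

primrec tm_interp :: "('o, 'a) moncat \<Rightarrow> 'o \<Rightarrow> (gen \<Rightarrow> 'a) \<Rightarrow> tm \<Rightarrow> 'a" where
  "tm_interp M A h (Gen g) = h g"
| "tm_interp M A h (Idn T) = Idt M (obj_interp M A T)"
| "tm_interp M A h (s \<odot> t) = Comp M (tm_interp M A h s) (tm_interp M A h t)"
| "tm_interp M A h (s \<boxtimes> t) = TensA M (tm_interp M A h s) (tm_interp M A h t)"
| "tm_interp M A h (Asc R S T) = Assoc M (obj_interp M A R) (obj_interp M A S) (obj_interp M A T)"
| "tm_interp M A h (AscI R S T) = Inv M (Assoc M (obj_interp M A R) (obj_interp M A S) (obj_interp M A T))"
| "tm_interp M A h (LUn T) = LUnit M (obj_interp M A T)"
| "tm_interp M A h (LUnI T) = Inv M (LUnit M (obj_interp M A T))"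
| "tm_interp M A h (RUn T) = RUnit M (obj_interp M A T)"
| "tm_interp M A h (RUnI T) = Inv M (RUnit M (obj_interp M A T))"

text \<open>Typing is kept apart from the axioms, because a structure that is pulled back along
  \<open>F\<close> is first known only to be well typed.\<close>

definition is_interpretation :: "('o, 'a) moncat \<Rightarrow> gen set \<Rightarrow> 'o \<Rightarrow> (gen \<Rightarrow> 'a) \<Rightarrow> bool" where
  "is_interpretation M \<Sigma> A h \<longleftrightarrow>
     A \<in> Obj M \<and> (\<forall>g \<in> \<Sigma>. h g \<in> Hom M (obj_interp M A (gen_dom g)) (obj_interp M A (gen_cod g)))"

text \<open>No generator names the inverse of the braiding, so its invertibility is a separate
  clause and not a member of \<open>E\<close>.\<close>

definition is_model ::
    "('o, 'a) moncat \<Rightarrow> gen set \<Rightarrow> (tm \<times> tm) set \<Rightarrow> 'o \<Rightarrow> (gen \<Rightarrow> 'a) \<Rightarrow> bool" where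
  "is_model M \<Sigma> E A h \<longleftrightarrow>
     is_interpretation M \<Sigma> A h \<and> (Braid \<in> \<Sigma> \<longrightarrow> iso M (h Braid)) \<and>
     (\<forall>(s, t) \<in> E. tm_interp M A h s = tm_interp M A h t)"

text \<open>One square for all structure maps. For \<open>Unt\<close> and \<open>Counit\<close> it
  differs from the usual condition by a composite with the identity of \<one>.\<close>

definition is_hom ::
    "('o, 'a) moncat \<Rightarrow> gen set \<Rightarrow> (gen \<Rightarrow> 'a) \<Rightarrow> (gen \<Rightarrow> 'a) \<Rightarrow> 'a \<Rightarrow> bool" where
  "is_hom M \<Sigma> h h' f \<longleftrightarrow>
     (\<forall>g \<in> \<Sigma>. map_interp M f (gen_cod g) \<cdot> h g = h' g \<cdot> map_interp M f (gen_dom g))" for M (structure)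

definition well_typed_axioms :: "gen set \<Rightarrow> (tm \<times> tm) set \<Rightarrow> bool" where
  "well_typed_axioms \<Sigma> E \<longleftrightarrow>
     (\<forall>(s, t) \<in> E. well_typed \<Sigma> s \<and> well_typed \<Sigma> t \<and> tm_dom s = tm_dom t \<and> tm_cod s = tm_cod t)"

section \<open>Interpretations, their typing and their morphisms\<close>

context monoidal_category
begin

lemma obj_interp_closed [simp]: "A \<in> Obj M \<Longrightarrow> obj_interp M A T \<in> Obj M"
  by (induction T) auto

lemma map_interp_simps [simp]:
  assumes "f \<in> Arr M"
  shows "map_interp M f T \<in> Arr M" "Dom M (map_interp M f T) = obj_interp M (Dom M f) T"
    "Cod M (map_interp M f T) = obj_interp M (Cod M f) T"
  using assms by (induction T) simp_all

lemma map_interp_closed: "f \<in> Hom M A B \<Longrightarrow> map_interp M f T \<in> Hom M (obj_interp M A T) (obj_interp M B T)"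
  by (auto simp: Hom_def)

lemma map_interp_Idt: "A \<in> Obj M \<Longrightarrow> map_interp M (\<i> A) T = \<i> (obj_interp M A T)"
  by (induction T) (simp_all add: Tens_Idt)

lemma map_interp_Comp:
  "f \<in> Arr M \<Longrightarrow> g \<in> Arr M \<Longrightarrow> Dom M g = Cod M f \<Longrightarrow> map_interp M (g \<cdot> f) T = map_interp M g T \<cdot> map_interp M f T"
  by (induction T) (simp_all add: interchange)

lemma iso_map_interp [simp]: "iso M f \<Longrightarrow> iso M (map_interp M f T)"
  by (induction T) simp_all

lemma map_interp_Inv:
  assumes "iso M f" shows "map_interp M (Inv M f) T = Inv M (map_interp M f T)"
proof (rule inverse_arrows_unique)
  have f: "f \<in> Arr M" by (rule iso_Arr[OF assms])
  show "inverse_arrows M (map_interp M f T) (Inv M (map_interp M f T))"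
    by (rule inverse_arrows_Inv[OF iso_map_interp[OF assms]])
  show "inverse_arrows M (map_interp M f T) (map_interp M (Inv M f) T)"
    using assms f map_interp_Comp[of f "Inv M f" T] map_interp_Comp[of "Inv M f" f T]
    by (simp add: inverse_arrows_def Hom_def map_interp_Idt Dom_closed Cod_closed)
qed

lemma is_hom_Idt:
  assumes "is_interpretation M \<Sigma> A h" shows "is_hom M \<Sigma> h h (\<i> A)"
  using assms by (auto simp: is_hom_def is_interpretation_def map_interp_Idt Hom_def)

lemma is_hom_Comp:
  assumes h: "is_interpretation M \<Sigma> A h" "is_interpretation M \<Sigma> A' h'" "is_interpretation M \<Sigma> A'' h''"
    and fg: "f \<in> Hom M A A'" "g \<in> Hom M A' A''" "is_hom M \<Sigma> h h' f" "is_hom M \<Sigma> h' h'' g"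
  shows "is_hom M \<Sigma> h h'' (g \<cdot> f)"
  unfolding is_hom_def
proof
  fix k assume k: "k \<in> \<Sigma>"
  note [simp] = fg(1)[unfolded Hom_def, simplified] fg(2)[unfolded Hom_def, simplified]
  have [simp]: "h k \<in> Arr M" "Dom M (h k) = obj_interp M A (gen_dom k)" "Cod M (h k) = obj_interp M A (gen_cod k)"
    "h' k \<in> Arr M" "Dom M (h' k) = obj_interp M A' (gen_dom k)" "Cod M (h' k) = obj_interp M A' (gen_cod k)"
    "h'' k \<in> Arr M" "Dom M (h'' k) = obj_interp M A'' (gen_dom k)" "Cod M (h'' k) = obj_interp M A'' (gen_cod k)"
    using h k by (auto simp: is_interpretation_def Hom_def)
  have e1: "map_interp M f (gen_cod k) \<cdot> h k = h' k \<cdot> map_interp M f (gen_dom k)"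
    and e2: "map_interp M g (gen_cod k) \<cdot> h' k = h'' k \<cdot> map_interp M g (gen_dom k)"
    using fg k by (auto simp: is_hom_def)
  have "map_interp M (g \<cdot> f) (gen_cod k) \<cdot> h k = map_interp M g (gen_cod k) \<cdot> (map_interp M f (gen_cod k) \<cdot> h k)"
    by (simp add: map_interp_Comp)
  also have "\<dots> = (map_interp M g (gen_cod k) \<cdot> h' k) \<cdot> map_interp M f (gen_dom k)" unfolding e1 by simp
  also have "\<dots> = h'' k \<cdot> map_interp M (g \<cdot> f) (gen_dom k)" unfolding e2 by (simp add: map_interp_Comp)
  finally show "map_interp M (g \<cdot> f) (gen_cod k) \<cdot> h k = h'' k \<cdot> map_interp M (g \<cdot> f) (gen_dom k)" .
qed

text \<open>Each defining square has invertible sides built from \<open>f\<close>; inverting them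
  with \<open>square_Inv\<close> gives the square for the inverse. This supplies
  \<open>P_Inv\<close>, on which every conservativity claim rests.\<close>

lemma is_hom_Inv:
  assumes h: "is_interpretation M \<Sigma> A h" "is_interpretation M \<Sigma> A' h'"
    and f: "f \<in> Hom M A A'" "iso M f" "is_hom M \<Sigma> h h' f"
  shows "is_hom M \<Sigma> h' h (Inv M f)"
  unfolding is_hom_def
proof
  fix k assume k: "k \<in> \<Sigma>"
  note ar = f(1)[unfolded Hom_def, simplified]
  have e: "h' k \<cdot> map_interp M f (gen_dom k) = map_interp M f (gen_cod k) \<cdot> h k"
    using f k by (auto simp: is_hom_def)
  have "h k \<cdot> Inv M (map_interp M f (gen_dom k)) = Inv M (map_interp M f (gen_cod k)) \<cdot> h' k"
    by (rule square_Inv[OF _ _ e])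
      (use h k f(2) ar in \<open>auto simp: is_interpretation_def\<close>)
  then show "map_interp M (Inv M f) (gen_cod k) \<cdot> h' k = h k \<cdot> map_interp M (Inv M f) (gen_dom k)"
    by (simp add: map_interp_Inv[OF f(2)])
qed

lemma tm_interp_simps:
  assumes "is_interpretation M \<Sigma> A h" "well_typed \<Sigma> t"
  shows "tm_interp M A h t \<in> Arr M \<and> Dom M (tm_interp M A h t) = obj_interp M A (tm_dom t) \<and>
    Cod M (tm_interp M A h t) = obj_interp M A (tm_cod t)"
  using assms by (induction t) (auto simp: is_interpretation_def Hom_def)

end

context monoidal_functor
begin

text \<open>The canonical isomorphism from the \<open>\<one>'\<close>, \<open>\<otimes>'\<close>-expression in \<open>A'\<close> to the image under \<open>F\<close> of the
  same expression in \<open>A\<close>, extending \<open>\<theta> : A' \<rightarrow> FA\<close>.\<close>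

primrec comparison :: "'o \<Rightarrow> 'b \<Rightarrow> tobj \<Rightarrow> 'b" where
  "comparison A \<theta> Var = \<theta>"
| "comparison A \<theta> One = \<phi>0"
| "comparison A \<theta> (Tensor S T) =
     \<phi>2 (obj_interp M A S) (obj_interp M A T) \<cdot> (comparison A \<theta> S \<otimes> comparison A \<theta> T)"

lemma comparison_simps [simp]:
  assumes "A \<in> Obj M" "\<theta> \<in> Arr M'" "Cod M' \<theta> = OMap F A"
  shows "comparison A \<theta> T \<in> Arr M'" "Dom M' (comparison A \<theta> T) = obj_interp M' (Dom M' \<theta>) T"
    "Cod M' (comparison A \<theta> T) = OMap F (obj_interp M A T)"
  using assms by (induction T) simp_all

lemma iso_comparison [simp]:
  assumes "A \<in> Obj M" "iso M' \<theta>" "Cod M' \<theta> = OMap F A"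
  shows "iso M' (comparison A \<theta> T)"
  using assms target.iso_Arr[OF assms(2)] by (induction T) simp_all

text \<open>Separates the part of a comparison map that comes from \<open>x\<close> inside the
  target category from the part that involves \<phi>.\<close>

lemma comparison_comp:
  assumes "A \<in> Obj M" "\<theta> \<in> Arr M'" "Cod M' \<theta> = OMap F A" "x \<in> Arr M'" "Cod M' x = Dom M' \<theta>"
  shows "comparison A (\<theta> \<cdot> x) T = comparison A \<theta> T \<cdot> map_interp M' x T"
  using assms by (induction T) (simp_all add: target.interchange)

lemma comparison_natural:
  assumes "f \<in> Hom M A B"
  shows "comparison B (AMap F f) T = AMap F (map_interp M f T) \<cdot> comparison A (\<i> (OMap F A)) T"
proof (induction T)
  case (Tensor S T)
  have o: "A \<in> Obj M" "B \<in> Obj M" using source.Hom_Obj[OF assms] by auto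
  show ?case
    unfolding comparison.simps obj_interp.simps map_interp.simps Tensor
    by (rule phi2_naturality[OF source.map_interp_closed[OF assms] source.map_interp_closed[OF assms]])
      (use o in \<open>simp_all add: Hom_def\<close>)
qed (use assms source.Hom_Obj[OF assms] in \<open>simp_all add: Hom_def AMap_Idt\<close>)

end

text \<open>The squares are assumed for the structure maps only; they are extended to all formal
  morphisms below.\<close>

locale comparison_situation = monoidal_functor +
  fixes \<Sigma> :: "gen set" and A :: 'a and h :: "gen \<Rightarrow> 'b" and A' :: 'c and h' :: "gen \<Rightarrow> 'd"
    and \<theta> :: 'd
  assumes h: "is_interpretation M \<Sigma> A h" and h': "is_interpretation M' \<Sigma> A' h'"
    and \<theta>: "\<theta> \<in> Hom M' A' (OMap F A)" "iso M' \<theta>"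
    and square: "g \<in> \<Sigma> \<Longrightarrow>
      comparison A \<theta> (gen_cod g) \<cdot> h' g = AMap F (h g) \<cdot> comparison A \<theta> (gen_dom g)"
begin

lemma objects [simp]: "A \<in> Obj M" "A' \<in> Obj M'"
  using h h' by (auto simp: is_interpretation_def)

lemma theta_simps [simp]: "\<theta> \<in> Arr M'" "Dom M' \<theta> = A'" "Cod M' \<theta> = OMap F A" "iso M' \<theta>"
  using \<theta> by (auto simp: Hom_def)

abbreviation "cmp \<equiv> comparison A \<theta>"

lemma cmp_Hom: "cmp T \<in> Hom M' (obj_interp M' A' T) (OMap F (obj_interp M A T))"
  by (simp add: Hom_def)

text \<open>Induction on the formal morphism: composites paste two squares, tensor products use
  naturality of \<open>\<phi>2\<close>, and each constraint is a coherence law of the monoidal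
  functor.\<close>

lemma tm_interp_square:
  "well_typed \<Sigma> t \<Longrightarrow> cmp (tm_cod t) \<cdot> tm_interp M' A' h' t = AMap F (tm_interp M A h t) \<cdot> cmp (tm_dom t)"
proof (induction t)
  case (Gen g)
  then show ?case by (simp add: square)
next
  case (Idn T)
  show ?case by (simp add: AMap_Idt)
next
  case (Cmp s t)
  note ar = source.tm_interp_simps[OF h, of s] source.tm_interp_simps[OF h, of t]
    target.tm_interp_simps[OF h', of s] target.tm_interp_simps[OF h', of t]
  have "cmp (tm_cod s) \<cdot> tm_interp M' A' h' s \<cdot> tm_interp M' A' h' t =
      (cmp (tm_cod s) \<cdot> tm_interp M' A' h' s) \<cdot> tm_interp M' A' h' t"
    using Cmp.prems ar by simp
  also have "\<dots> = AMap F (tm_interp M A h s) \<cdot> (cmp (tm_cod t) \<cdot> tm_interp M' A' h' t)"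
    using Cmp.prems Cmp.IH(1) ar by simp
  also have "\<dots> = (AMap F (tm_interp M A h s) \<cdot> AMap F (tm_interp M A h t)) \<cdot> cmp (tm_dom t)"
    using Cmp.prems Cmp.IH(2) ar by simp
  also have "\<dots> = AMap F (tm_interp M A h (s \<odot> t)) \<cdot> cmp (tm_dom t)"
    using Cmp.prems ar by (simp add: AMap_Comp_simp)
  finally show ?case by simp
next
  case (Ten s t)
  note ar = source.tm_interp_simps[OF h, of s] source.tm_interp_simps[OF h, of t]
    target.tm_interp_simps[OF h', of s] target.tm_interp_simps[OF h', of t]
  have "cmp (tm_cod (s \<boxtimes> t)) \<cdot> tm_interp M' A' h' (s \<boxtimes> t) =
      \<phi>2 (obj_interp M A (tm_cod s)) (obj_interp M A (tm_cod t)) \<cdot>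
        ((cmp (tm_cod s) \<cdot> tm_interp M' A' h' s) \<otimes> (cmp (tm_cod t) \<cdot> tm_interp M' A' h' t))"
    using Ten.prems ar by (simp add: target.interchange)
  also have "\<dots> = \<phi>2 (obj_interp M A (tm_cod s)) (obj_interp M A (tm_cod t)) \<cdot>
      ((AMap F (tm_interp M A h s) \<cdot> cmp (tm_dom s)) \<otimes> (AMap F (tm_interp M A h t) \<cdot> cmp (tm_dom t)))"
    using Ten.prems Ten.IH by simp
  also have "\<dots> = AMap F (tm_interp M A h (s \<boxtimes> t)) \<cdot> cmp (tm_dom (s \<boxtimes> t))"
    unfolding tm_interp.simps tm_dom.simps comparison.simps
    by (rule phi2_naturality[OF _ _ cmp_Hom cmp_Hom]) (use Ten.prems ar in \<open>auto simp: Hom_def\<close>)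
  finally show ?case .
next
  case (Asc R S T)
  show ?case using phi2_associativity[OF _ _ _ cmp_Hom cmp_Hom cmp_Hom, of R S T] by simp
next
  case (AscI R S T)
  \<comment> \<open>The square for the associator itself, which \<open>square_Inv\<close> then turns
    round; the inverse unit constraints are handled alike.\<close>
  have "cmp (Tensor R (Tensor S T)) \<cdot> \<a> (obj_interp M' A' R) (obj_interp M' A' S) (obj_interp M' A' T) =
      AMap F (\<a>\<^bsub>M\<^esub> (obj_interp M A R) (obj_interp M A S) (obj_interp M A T)) \<cdot> cmp (Tensor (Tensor R S) T)"
    using phi2_associativity[OF _ _ _ cmp_Hom cmp_Hom cmp_Hom, of R S T] by simp
  from target.square_Inv[OF _ _ this] show ?case
    by (simp add: Hom_def AMap_Inv iso_AMap del: comparison.simps)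
next
  case (LUn T)
  show ?case using phi_left_unit[OF _ cmp_Hom, of T] by simp
next
  case (LUnI T)
  have "cmp T \<cdot> \<l> (obj_interp M' A' T) = AMap F (\<l>\<^bsub>M\<^esub> (obj_interp M A T)) \<cdot> cmp (Tensor One T)"
    using phi_left_unit[OF _ cmp_Hom, of T] by simp
  from target.square_Inv[OF _ _ this] show ?case
    by (simp add: Hom_def AMap_Inv iso_AMap del: comparison.simps)
next
  case (RUn T)
  show ?case using phi_right_unit[OF _ cmp_Hom, of T] by simp
next
  case (RUnI T)
  have "cmp T \<cdot> \<r> (obj_interp M' A' T) = AMap F (\<r>\<^bsub>M\<^esub> (obj_interp M A T)) \<cdot> cmp (Tensor T One)"
    using phi_right_unit[OF _ cmp_Hom, of T] by simp
  from target.square_Inv[OF _ _ this] show ?case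
    by (simp add: Hom_def AMap_Inv iso_AMap del: comparison.simps)
qed

text \<open>If both sides of an axiom agree in \<open>A\<close>, their squares have the same
  composite through \<open>F\<close>, and the invertible comparison map at the common codomain
  cancels on the left.\<close>

lemma model_transfer:
  assumes E: "well_typed_axioms \<Sigma> E" and m: "is_model M \<Sigma> E A h"
  shows "is_model M' \<Sigma> E A' h'"
  unfolding is_model_def
proof (intro conjI impI ballI)
  show "is_interpretation M' \<Sigma> A' h'" by (rule h')
  show "iso M' (h' Braid)" if B: "Braid \<in> \<Sigma>"
  proof -
    have b: "h' Braid \<in> Hom M' (obj_interp M' A' (gen_dom Braid)) (obj_interp M' A' (gen_cod Braid))"
      "h Braid \<in> Hom M (obj_interp M A (gen_dom Braid)) (obj_interp M A (gen_cod Braid))"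
      using h h' B unfolding is_interpretation_def by blast+
    have i: "iso M (h Braid)" using m B by (simp add: is_model_def)
    \<comment> \<open>The square exhibits \<open>h' Braid\<close> as a composite of
      \<open>F (h Braid)\<close> with isomorphisms on either side.\<close>
    have "h' Braid = Inv M' (cmp (gen_cod Braid)) \<cdot> (cmp (gen_cod Braid) \<cdot> h' Braid)"
      using b by (simp add: Hom_def del: gen_cod.simps gen_dom.simps comparison.simps)
    also have "\<dots> = Inv M' (cmp (gen_cod Braid)) \<cdot> AMap F (h Braid) \<cdot> cmp (gen_dom Braid)"
      unfolding square[OF B] ..
    also have "iso M' \<dots>"
      using i b by (simp add: iso_AMap Hom_def del: gen_cod.simps gen_dom.simps comparison.simps)
    finally show ?thesis .
  qed
  fix e assume e: "e \<in> E"
  obtain s t where st: "e = (s, t)" by (cases e)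
  have wt: "well_typed \<Sigma> s" "well_typed \<Sigma> t" "tm_dom s = tm_dom t" "tm_cod s = tm_cod t"
    using E e st by (auto simp: well_typed_axioms_def)
  have "tm_interp M A h s = tm_interp M A h t" using m e st by (auto simp: is_model_def)
  then have "cmp (tm_cod t) \<cdot> tm_interp M' A' h' s = cmp (tm_cod t) \<cdot> tm_interp M' A' h' t"
    using tm_interp_square[OF wt(1)] tm_interp_square[OF wt(2)] wt by simp
  from target.iso_cancel_left[OF _ this] show "case e of (s, t) \<Rightarrow> tm_interp M' A' h' s = tm_interp M' A' h' t"
    using target.tm_interp_simps[OF h' wt(1)] target.tm_interp_simps[OF h' wt(2)] wt st by simp
qed

text \<open>Now the comparison map at the common domain cancels on the right, leaving an equation
  between images under \<open>F\<close>, which faithfulness removes. Conservativity of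
  \<open>F\<close> recovers invertibility of the braiding.\<close>

lemma model_reflect:
  assumes E: "well_typed_axioms \<Sigma> E" and F: "faithful M M' F" "is_conservative M M' F"
    and m: "is_model M' \<Sigma> E A' h'"
  shows "is_model M \<Sigma> E A h"
  unfolding is_model_def
proof (intro conjI impI ballI)
  show "is_interpretation M \<Sigma> A h" by (rule h)
  show "iso M (h Braid)" if B: "Braid \<in> \<Sigma>"
  proof -
    have b: "h' Braid \<in> Hom M' (obj_interp M' A' (gen_dom Braid)) (obj_interp M' A' (gen_cod Braid))"
      "h Braid \<in> Hom M (obj_interp M A (gen_dom Braid)) (obj_interp M A (gen_cod Braid))"
      using h h' B unfolding is_interpretation_def by blast+
    have i: "iso M' (h' Braid)" using m B by (simp add: is_model_def)
    have "AMap F (h Braid) = (AMap F (h Braid) \<cdot> cmp (gen_dom Braid)) \<cdot> Inv M' (cmp (gen_dom Braid))"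
      using b by (simp add: Hom_def del: gen_cod.simps gen_dom.simps comparison.simps)
    also have "\<dots> = (cmp (gen_cod Braid) \<cdot> h' Braid) \<cdot> Inv M' (cmp (gen_dom Braid))"
      unfolding square[OF B] ..
    also have "iso M' \<dots>"
      using i b by (simp add: iso_AMap Hom_def del: gen_cod.simps gen_dom.simps comparison.simps)
    finally show ?thesis using F(2) b by (simp add: is_conservative_def Hom_def)
  qed
  fix e assume e: "e \<in> E"
  obtain s t where st: "e = (s, t)" by (cases e)
  have wt: "well_typed \<Sigma> s" "well_typed \<Sigma> t" "tm_dom s = tm_dom t" "tm_cod s = tm_cod t"
    using E e st by (auto simp: well_typed_axioms_def)
  note ar = source.tm_interp_simps[OF h wt(1)] source.tm_interp_simps[OF h wt(2)]
  have "tm_interp M' A' h' s = tm_interp M' A' h' t" using m e st by (auto simp: is_model_def)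
  then have "AMap F (tm_interp M A h s) \<cdot> cmp (tm_dom t) = AMap F (tm_interp M A h t) \<cdot> cmp (tm_dom t)"
    using tm_interp_square[OF wt(1)] tm_interp_square[OF wt(2)] wt by simp
  from target.iso_cancel_right[OF _ this] have "AMap F (tm_interp M A h s) = AMap F (tm_interp M A h t)"
    using ar wt by simp
  from faithfulD[OF F(1) this, of "obj_interp M A (tm_dom t)" "obj_interp M A (tm_cod t)"]
  show "case e of (s, t) \<Rightarrow> tm_interp M A h s = tm_interp M A h t"
    using ar wt st by (simp add: Hom_def)
qed

end

section \<open>Models and the functors they induce\<close>

text \<open>Structured objects stay tuples such as \<open>(A, m, u)\<close>. The two assumptions say
  that a tuple amounts to an object together with an arbitrary choice of arrows for the names in
  \<open>\<Sigma>\<close>.\<close>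

locale model_category = monoidal_category M
  for M :: "('o, 'a) moncat" (structure) +
  fixes \<Sigma> :: "gen set" and E :: "(tm \<times> tm) set" and U :: "'s \<Rightarrow> 'o" and ops :: "'s \<Rightarrow> gen \<Rightarrow> 'a"
  assumes extensional: "U X = U Y \<Longrightarrow> (\<forall>g \<in> \<Sigma>. ops X g = ops Y g) \<Longrightarrow> X = Y"
    and exhaustive: "\<exists>X. U X = A \<and> (\<forall>g \<in> \<Sigma>. ops X g = h g)"
begin

abbreviation "models \<equiv> {X. is_model M \<Sigma> E (U X) (ops X)}"
abbreviation "homs X Y f \<equiv> is_hom M \<Sigma> (ops X) (ops Y) f"

lemma models_interpretation: "X \<in> models \<Longrightarrow> is_interpretation M \<Sigma> (U X) (ops X)"
  by (simp add: is_model_def)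

sublocale structured_category M models U homs
proof
  fix X Y Z f g
  show "U X \<in> Obj M" if "X \<in> models"
    using models_interpretation[OF that] by (simp add: is_interpretation_def)
  show "homs X X (\<i> (U X))" if "X \<in> models"
    by (rule is_hom_Idt[OF models_interpretation[OF that]])
  show "homs X Z (g \<cdot> f)" if "X \<in> models" "Y \<in> models" "Z \<in> models" "f \<in> Hom M (U X) (U Y)"
    "g \<in> Hom M (U Y) (U Z)" "homs X Y f" "homs Y Z g"
    by (rule is_hom_Comp[OF models_interpretation[OF that(1)] models_interpretation[OF that(2)]
          models_interpretation[OF that(3)] that(4-7)])
  show "homs Y X (Inv M f)" if "X \<in> models" "Y \<in> models" "f \<in> Hom M (U X) (U Y)" "iso M f" "homs X Y f"
    by (rule is_hom_Inv[OF models_interpretation[OF that(1)] models_interpretation[OF that(2)] that(3-5)])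
qed

text \<open>The squares of an identity read \<open>ops X g = ops Y g\<close>.\<close>

lemma models_amnestic:
  assumes "X \<in> models" "Y \<in> models" "U X = U Y" "homs X Y (\<i> (U X))" shows "X = Y"
proof (rule extensional[OF assms(3)], rule ballI)
  fix g assume g: "g \<in> \<Sigma>"
  have "ops X g \<in> Hom M (obj_interp M (U X) (gen_dom g)) (obj_interp M (U X) (gen_cod g))"
    "ops Y g \<in> Hom M (obj_interp M (U X) (gen_dom g)) (obj_interp M (U X) (gen_cod g))"
    using assms(3) g models_interpretation[OF assms(1)] models_interpretation[OF assms(2)]
    by (simp_all add: is_interpretation_def)
  moreover have "map_interp M (\<i> (U X)) (gen_cod g) \<cdot> ops X g = ops Y g \<cdot> map_interp M (\<i> (U X)) (gen_dom g)"
    using assms(4) g by (simp add: is_hom_def)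
  ultimately show "ops X g = ops Y g"
    using U_closed[OF assms(1)] by (simp add: map_interp_Idt Hom_def)
qed

end

primrec induced ::
    "('p, 'b) moncat \<Rightarrow> ('o, 'a, 'p, 'b) fctr \<Rightarrow> 'b \<Rightarrow> ('o \<Rightarrow> 'o \<Rightarrow> 'b) \<Rightarrow> 'o \<Rightarrow> 'a \<Rightarrow> gen \<Rightarrow> 'b" where
  "induced M' F \<phi>0 \<phi>2 A x Mul = ind_m M' F \<phi>2 A x"
| "induced M' F \<phi>0 \<phi>2 A x Unt = ind_u M' F \<phi>0 x"
| "induced M' F \<phi>0 \<phi>2 A x Comul = ind_Delta M' F \<phi>2 A x"
| "induced M' F \<phi>0 \<phi>2 A x Counit = ind_eps M' F \<phi>0 x"
| "induced M' F \<phi>0 \<phi>2 A x Braid = ind_c M' F \<phi>2 A x"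

context monoidal_functor
begin

abbreviation "canonical A \<equiv> comparison A (\<i> (OMap F A))"

lemma induced_closed:
  assumes "A \<in> Obj M" "x \<in> Hom M (obj_interp M A (gen_dom g)) (obj_interp M A (gen_cod g))"
  shows "induced M' F \<phi>0 \<phi>2 A x g \<in> Hom M' (obj_interp M' (OMap F A) (gen_dom g)) (obj_interp M' (OMap F A) (gen_cod g))"
  using assms
  by (cases g) (simp_all add: ind_m_def ind_u_def ind_Delta_def ind_eps_def ind_c_def Hom_def)

text \<open>The five formulas are \<open>F x\<close> conjugated by the comparison maps at \<theta> =
  Id. These are the identity, \<open>\<phi>0\<close> and \<open>\<phi>2 A A\<close> on the three
  tensor expressions that occur as domains and codomains.\<close>

lemma induced_square:
  assumes "A \<in> Obj M" "x \<in> Hom M (obj_interp M A (gen_dom g)) (obj_interp M A (gen_cod g))"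
  shows "canonical A (gen_cod g) \<cdot> induced M' F \<phi>0 \<phi>2 A x g = AMap F x \<cdot> canonical A (gen_dom g)"
  using assms
  by (cases g)
    (simp_all add: ind_m_def ind_u_def ind_Delta_def ind_eps_def ind_c_def Hom_def target.Tens_Idt)

end

locale model_lift = monoidal_functor M M' F \<phi>0 \<phi>2 +
  src: model_category M \<Sigma> E U ops + tgt: model_category M' \<Sigma> E U' ops'
  for M :: "('o, 'a) moncat" and M' :: "('p, 'b) moncat" (structure)
    and F :: "('o, 'a, 'p, 'b) fctr" and \<phi>0 \<phi>2
    and \<Sigma> E and U :: "'s \<Rightarrow> 'o" and ops and U' :: "'t \<Rightarrow> 'p" and ops' +
  fixes T :: "'s \<Rightarrow> 't"
  assumes well_typed: "well_typed_axioms \<Sigma> E"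
    and U'_T: "U' (T X) = OMap F (U X)"
    and ops'_T: "g \<in> \<Sigma> \<Longrightarrow> ops' (T X) g = induced M' F \<phi>0 \<phi>2 (U X) (ops X g) g"
begin

lemma interpretation_T:
  assumes "is_interpretation M \<Sigma> (U X) (ops X)"
  shows "is_interpretation M' \<Sigma> (U' (T X)) (ops' (T X))"
  using assms by (simp add: is_interpretation_def U'_T ops'_T induced_closed)

lemma square_T:
  assumes "is_interpretation M \<Sigma> (U X) (ops X)" "g \<in> \<Sigma>"
  shows "canonical (U X) (gen_cod g) \<cdot> ops' (T X) g = AMap F (ops X g) \<cdot> canonical (U X) (gen_dom g)"
  using assms by (simp add: is_interpretation_def ops'_T induced_square)

text \<open>Translates the morphism condition inside the target into the squares required by
  \<open>comparison_situation\<close>; the two differ by an invertible canonical comparison map on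
  the left.\<close>

lemma hom_T_iff:
  assumes X: "is_interpretation M \<Sigma> (U X) (ops X)" and A': "is_interpretation M' \<Sigma> A' h'"
    and \<theta>: "\<theta> \<in> Hom M' A' (OMap F (U X))"
  shows "is_hom M' \<Sigma> h' (ops' (T X)) \<theta> \<longleftrightarrow>
    (\<forall>g \<in> \<Sigma>. comparison (U X) \<theta> (gen_cod g) \<cdot> h' g = AMap F (ops X g) \<cdot> comparison (U X) \<theta> (gen_dom g))"
  unfolding is_hom_def
proof (rule ball_cong[OF refl])
  fix g assume g: "g \<in> \<Sigma>"
  have UX: "U X \<in> Obj M" using X by (simp add: is_interpretation_def)
  have o [simp]: "OMap F (U X) \<in> Obj M'" using UX by simp
  have ar: "h' g \<in> Arr M'" "Dom M' (h' g) = obj_interp M' A' (gen_dom g)" "Cod M' (h' g) = obj_interp M' A' (gen_cod g)"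
    "ops' (T X) g \<in> Arr M'" "Dom M' (ops' (T X) g) = obj_interp M' (OMap F (U X)) (gen_dom g)"
    "Cod M' (ops' (T X) g) = obj_interp M' (OMap F (U X)) (gen_cod g)"
    "ops X g \<in> Arr M" "Dom M (ops X g) = obj_interp M (U X) (gen_dom g)" "Cod M (ops X g) = obj_interp M (U X) (gen_cod g)"
    "\<theta> \<in> Arr M'" "Dom M' \<theta> = A'" "Cod M' \<theta> = OMap F (U X)"
    using X interpretation_T[OF X] A' \<theta> g by (auto simp: is_interpretation_def Hom_def U'_T)
  \<comment> \<open>This is \<open>comparison_comp\<close> for \<theta> written as the identity of
    \<open>F (U X)\<close> after \<theta>.\<close>
  have c: "comparison (U X) \<theta> S = canonical (U X) S \<cdot> map_interp M' \<theta> S" for S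
    using comparison_comp[of "U X" "\<i> (OMap F (U X))" \<theta> S] ar UX by simp
  have l: "comparison (U X) \<theta> (gen_cod g) \<cdot> h' g =
      canonical (U X) (gen_cod g) \<cdot> map_interp M' \<theta> (gen_cod g) \<cdot> h' g"
    unfolding c using ar UX by simp
  have "AMap F (ops X g) \<cdot> comparison (U X) \<theta> (gen_dom g) =
      (AMap F (ops X g) \<cdot> canonical (U X) (gen_dom g)) \<cdot> map_interp M' \<theta> (gen_dom g)"
    unfolding c using ar UX by simp
  also have "\<dots> = canonical (U X) (gen_cod g) \<cdot> ops' (T X) g \<cdot> map_interp M' \<theta> (gen_dom g)"
    unfolding square_T[OF X g, symmetric] using ar UX by simp
  finally have r: "AMap F (ops X g) \<cdot> comparison (U X) \<theta> (gen_dom g) =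
      canonical (U X) (gen_cod g) \<cdot> ops' (T X) g \<cdot> map_interp M' \<theta> (gen_dom g)" .
  have i: "iso M' (canonical (U X) (gen_cod g))" using UX by simp
  show "map_interp M' \<theta> (gen_cod g) \<cdot> h' g = ops' (T X) g \<cdot> map_interp M' \<theta> (gen_dom g) \<longleftrightarrow>
    comparison (U X) \<theta> (gen_cod g) \<cdot> h' g = AMap F (ops X g) \<cdot> comparison (U X) \<theta> (gen_dom g)"
    unfolding l r
  proof
    assume eq: "canonical (U X) (gen_cod g) \<cdot> map_interp M' \<theta> (gen_cod g) \<cdot> h' g =
      canonical (U X) (gen_cod g) \<cdot> ops' (T X) g \<cdot> map_interp M' \<theta> (gen_dom g)"
    show "map_interp M' \<theta> (gen_cod g) \<cdot> h' g = ops' (T X) g \<cdot> map_interp M' \<theta> (gen_dom g)"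
      by (rule target.iso_cancel_left[OF i eq]) (use ar UX in simp_all)
  qed simp
qed

lemma situation:
  assumes X: "is_interpretation M \<Sigma> (U X) (ops X)" and A': "is_interpretation M' \<Sigma> A' h'"
    and \<theta>: "\<theta> \<in> Hom M' A' (OMap F (U X))" "iso M' \<theta>" "is_hom M' \<Sigma> h' (ops' (T X)) \<theta>"
  shows "comparison_situation M M' F \<phi>0 \<phi>2 \<Sigma> (U X) (ops X) A' h' \<theta>"
  using assms hom_T_iff[OF X A' \<theta>(1)] by unfold_locales auto

text \<open>Naturality of the comparison maps turns the condition on \<open>F f\<close> into the
  image under \<open>F\<close> of the condition on \<open>f\<close>. Preservation of morphisms is
  then immediate, and reflection is faithfulness.\<close>

lemma hom_AMap_iff:
  assumes X: "is_interpretation M \<Sigma> (U X) (ops X)" and Y: "is_interpretation M \<Sigma> (U Y) (ops Y)"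
    and f: "f \<in> Hom M (U X) (U Y)"
  shows "is_hom M' \<Sigma> (ops' (T X)) (ops' (T Y)) (AMap F f) \<longleftrightarrow>
    (\<forall>g \<in> \<Sigma>. AMap F (Comp M (map_interp M f (gen_cod g)) (ops X g)) = AMap F (Comp M (ops Y g) (map_interp M f (gen_dom g))))"
  unfolding hom_T_iff[OF Y interpretation_T[OF X, unfolded U'_T] AMap_closed[OF f]]
proof (rule ball_cong[OF refl])
  fix g assume g: "g \<in> \<Sigma>"
  have o: "U X \<in> Obj M" "U Y \<in> Obj M" using X Y by (auto simp: is_interpretation_def)
  have ar: "ops X g \<in> Arr M" "Dom M (ops X g) = obj_interp M (U X) (gen_dom g)" "Cod M (ops X g) = obj_interp M (U X) (gen_cod g)"
    "ops Y g \<in> Arr M" "Dom M (ops Y g) = obj_interp M (U Y) (gen_dom g)" "Cod M (ops Y g) = obj_interp M (U Y) (gen_cod g)"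
    "ops' (T X) g \<in> Arr M'" "Dom M' (ops' (T X) g) = obj_interp M' (OMap F (U X)) (gen_dom g)"
    "Cod M' (ops' (T X) g) = obj_interp M' (OMap F (U X)) (gen_cod g)"
    "f \<in> Arr M" "Dom M f = U X" "Cod M f = U Y"
    using X Y interpretation_T[OF X] f g by (auto simp: is_interpretation_def Hom_def U'_T)
  note c = comparison_natural[OF f]
  have "comparison (U Y) (AMap F f) (gen_cod g) \<cdot> ops' (T X) g =
      AMap F (map_interp M f (gen_cod g)) \<cdot> canonical (U X) (gen_cod g) \<cdot> ops' (T X) g"
    unfolding c using ar o by simp
  also have "\<dots> = AMap F (Comp M (map_interp M f (gen_cod g)) (ops X g)) \<cdot> canonical (U X) (gen_dom g)"
    unfolding square_T[OF X g] using ar o by (simp add: AMap_Comp_simp)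
  finally have l: "comparison (U Y) (AMap F f) (gen_cod g) \<cdot> ops' (T X) g =
      AMap F (Comp M (map_interp M f (gen_cod g)) (ops X g)) \<cdot> canonical (U X) (gen_dom g)" .
  have r: "AMap F (ops Y g) \<cdot> comparison (U Y) (AMap F f) (gen_dom g) =
      AMap F (Comp M (ops Y g) (map_interp M f (gen_dom g))) \<cdot> canonical (U X) (gen_dom g)"
    unfolding c using ar o by (simp add: AMap_Comp_simp)
  have i: "iso M' (canonical (U X) (gen_dom g))" using o by simp
  show "(comparison (U Y) (AMap F f) (gen_cod g) \<cdot> ops' (T X) g =
      AMap F (ops Y g) \<cdot> comparison (U Y) (AMap F f) (gen_dom g)) \<longleftrightarrow>
    AMap F (Comp M (map_interp M f (gen_cod g)) (ops X g)) = AMap F (Comp M (ops Y g) (map_interp M f (gen_dom g)))"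
    unfolding l r
  proof
    assume eq: "AMap F (Comp M (map_interp M f (gen_cod g)) (ops X g)) \<cdot> canonical (U X) (gen_dom g) =
      AMap F (Comp M (ops Y g) (map_interp M f (gen_dom g))) \<cdot> canonical (U X) (gen_dom g)"
    show "AMap F (Comp M (map_interp M f (gen_cod g)) (ops X g)) = AMap F (Comp M (ops Y g) (map_interp M f (gen_dom g)))"
      by (rule target.iso_cancel_right[OF i eq]) (use ar o in simp_all)
  qed simp
qed

text \<open>The case \<theta> = Id of the transfer, where the required squares say that the identity
  is a morphism.\<close>

lemma T_models:
  assumes X: "X \<in> src.models" shows "T X \<in> tgt.models"
proof -
  note i = src.models_interpretation[OF X]
  have o: "OMap F (U X) \<in> Obj M'" using src.U_closed[OF X] by simp
  interpret comparison_situation M M' F \<phi>0 \<phi>2 \<Sigma> "U X" "ops X" "U' (T X)" "ops' (T X)" "\<i> (OMap F (U X))"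
    by (rule situation[OF i interpretation_T[OF i]])
      (use o target.is_hom_Idt[OF interpretation_T[OF i]] in \<open>simp_all add: U'_T target.Idt_closed\<close>)
  show ?thesis using model_transfer[OF well_typed] X by simp
qed

sublocale lift: transportable_lift M src.models U src.homs M' tgt.models U' tgt.homs F T
proof
  fix X Y f
  show "T X \<in> tgt.models" if "X \<in> src.models" by (rule T_models[OF that])
  show "U' (T X) = OMap F (U X)" by (rule U'_T)
  show "tgt.homs (T X) (T Y) (AMap F f)"
    if "X \<in> src.models" "Y \<in> src.models" "f \<in> Hom M (U X) (U Y)" "src.homs X Y f"
    using hom_AMap_iff[OF src.models_interpretation[OF that(1)] src.models_interpretation[OF that(2)] that(3)]
      that(4) by (simp add: is_hom_def)
  show "src.homs X Y f"
    if F: "faithful M M' F" and o: "X \<in> src.models" "Y \<in> src.models" and f: "f \<in> Hom M (U X) (U Y)"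
      and hom: "tgt.homs (T X) (T Y) (AMap F f)"
    unfolding is_hom_def
  proof
    note X = src.models_interpretation[OF o(1)] and Y = src.models_interpretation[OF o(2)]
    fix g assume g: "g \<in> \<Sigma>"
    have x: "ops X g \<in> Hom M (obj_interp M (U X) (gen_dom g)) (obj_interp M (U X) (gen_cod g))"
      and y: "ops Y g \<in> Hom M (obj_interp M (U Y) (gen_dom g)) (obj_interp M (U Y) (gen_cod g))"
      using X Y g by (simp_all add: is_interpretation_def)
    have "AMap F (Comp M (map_interp M f (gen_cod g)) (ops X g)) = AMap F (Comp M (ops Y g) (map_interp M f (gen_dom g)))"
      using hom_AMap_iff[OF X Y f] hom g by blast
    from faithfulD[OF F this source.Comp_closed[OF x source.map_interp_closed[OF f]]
        source.Comp_closed[OF source.map_interp_closed[OF f] y]]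
    show "Comp M (map_interp M f (gen_cod g)) (ops X g) = Comp M (ops Y g) (map_interp M f (gen_dom g))" .
  qed
  show "\<exists>X\<in>src.models. U X = A \<and> tgt.homs X' (T X) \<theta>"
    if F: "faithful M M' F" "full M M' F" and X': "X' \<in> tgt.models" and A: "A \<in> Obj M"
      and \<theta>: "\<theta> \<in> Hom M' (U' X') (OMap F A)" "iso M' \<theta>" for X' A \<theta>
  proof -
    note i' = tgt.models_interpretation[OF X']
    have th: "\<theta> \<in> Arr M'" "Dom M' \<theta> = U' X'" "Cod M' \<theta> = OMap F A" using \<theta> by (auto simp: Hom_def)
    \<comment> \<open>The structure of \<open>X'\<close> carried along \<theta> to arrows between
      images under \<open>F\<close>. Any preimage of \<open>?k g\<close> makes the comparison square
      commute.\<close>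
    let ?k = "\<lambda>g. comparison A \<theta> (gen_cod g) \<cdot> ops' X' g \<cdot> Inv M' (comparison A \<theta> (gen_dom g))"
    have ar: "ops' X' g \<in> Arr M'" "Dom M' (ops' X' g) = obj_interp M' (U' X') (gen_dom g)"
      "Cod M' (ops' X' g) = obj_interp M' (U' X') (gen_cod g)" if "g \<in> \<Sigma>" for g
      using i' that by (auto simp: is_interpretation_def Hom_def)
    have "\<exists>x. x \<in> Hom M (obj_interp M A (gen_dom g)) (obj_interp M A (gen_cod g)) \<and> AMap F x = ?k g" if "g \<in> \<Sigma>" for g
    proof -
      have "?k g \<in> Hom M' (OMap F (obj_interp M A (gen_dom g))) (OMap F (obj_interp M A (gen_cod g)))"
        using ar[OF that] A th \<theta>(2) by (simp add: Hom_def)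
      from fullE[OF F(2) source.obj_interp_closed[OF A] source.obj_interp_closed[OF A] this] show ?thesis by blast
    qed
    then obtain h where h: "\<And>g. g \<in> \<Sigma> \<Longrightarrow> h g \<in> Hom M (obj_interp M A (gen_dom g)) (obj_interp M A (gen_cod g)) \<and> AMap F (h g) = ?k g"
      by metis
    \<comment> \<open>At this point \<open>X\<close> is just a tuple of well-typed arrows; its
      axioms follow from those of \<open>X'\<close> by \<open>model_reflect\<close>.\<close>
    obtain X where X: "U X = A" "\<And>g. g \<in> \<Sigma> \<Longrightarrow> ops X g = h g"
      using src.exhaustive[of A h] by blast
    have i: "is_interpretation M \<Sigma> (U X) (ops X)"
      using X A h by (simp add: is_interpretation_def)
    have "\<forall>g \<in> \<Sigma>. comparison (U X) \<theta> (gen_cod g) \<cdot> ops' X' g = AMap F (ops X g) \<cdot> comparison (U X) \<theta> (gen_dom g)"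
    proof
      fix g assume g: "g \<in> \<Sigma>"
      have "AMap F (ops X g) = ?k g" using h[OF g] X(2)[OF g] by simp
      then show "comparison (U X) \<theta> (gen_cod g) \<cdot> ops' X' g = AMap F (ops X g) \<cdot> comparison (U X) \<theta> (gen_dom g)"
        using ar[OF g] A th \<theta>(2) X(1) by simp
    qed
    then have hom: "tgt.homs X' (T X) \<theta>" using hom_T_iff[OF i i'] \<theta>(1) X(1) by simp
    interpret comparison_situation M M' F \<phi>0 \<phi>2 \<Sigma> "U X" "ops X" "U' X'" "ops' X'" \<theta>
      by (rule situation[OF i i' _ \<theta>(2) hom]) (use \<theta>(1) X(1) in simp)
    have "X \<in> src.models"
      using model_reflect[OF well_typed F(1) fully_faithful_conservative[OF cat_functor_axioms F]] X' by simp
    then show ?thesis using X(1) hom by blast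
  qed
  show "X = Y" if "X \<in> src.models" "Y \<in> src.models" "U X = U Y" "src.homs X Y (Idt M (U X))"
    using that by (rule src.models_amnestic)
  show "X' = Y'" if "X' \<in> tgt.models" "Y' \<in> tgt.models" "U' X' = U' Y'" "tgt.homs X' Y' (Idt M' (U' X'))"
    for X' Y'
    using that by (rule tgt.models_amnestic)
qed

lemmas properties =
  lift.cat_functor_lift lift.is_equivalence_lift lift.is_cat_isomorphism_lift
  lift.is_conservative_lift

end

section \<open>Algebras, coalgebras and braidings as models\<close>

abbreviation braid_first :: tm where "braid_first \<equiv> Gen Braid \<boxtimes> Idn Var"
abbreviation braid_last :: tm where "braid_last \<equiv> Idn Var \<boxtimes> Gen Braid"
abbreviation assoc :: tm where "assoc \<equiv> Asc Var Var Var"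
abbreviation assoc_inv :: tm where "assoc_inv \<equiv> AscI Var Var Var"

text \<open>In all these sets the terms copy the bracketing of the corresponding predicate, so that
  interpreting them gives back its equations literally.\<close>

definition alg_axioms :: "(tm \<times> tm) set" where
  "alg_axioms =
    {(Gen Mul \<odot> (Gen Mul \<boxtimes> Idn Var), Gen Mul \<odot> (Idn Var \<boxtimes> Gen Mul) \<odot> assoc),
     (Gen Mul \<odot> (Gen Unt \<boxtimes> Idn Var), LUn Var),
     (Gen Mul \<odot> (Idn Var \<boxtimes> Gen Unt), RUn Var)}"

definition coalg_axioms :: "(tm \<times> tm) set" where
  "coalg_axioms =
    {(assoc \<odot> (Gen Comul \<boxtimes> Idn Var) \<odot> Gen Comul, (Idn Var \<boxtimes> Gen Comul) \<odot> Gen Comul),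
     (LUn Var \<odot> (Gen Counit \<boxtimes> Idn Var) \<odot> Gen Comul, Idn Var),
     (RUn Var \<odot> (Idn Var \<boxtimes> Gen Counit) \<odot> Gen Comul, Idn Var)}"

definition braid_axioms :: "(tm \<times> tm) set" where
  "braid_axioms =
    {(braid_first \<odot> assoc_inv \<odot> braid_last \<odot> assoc \<odot> braid_first,
      assoc_inv \<odot> braid_last \<odot> assoc \<odot> braid_first \<odot> assoc_inv \<odot> braid_last \<odot> assoc)}"

definition braid_alg_axioms :: "(tm \<times> tm) set" where
  "braid_alg_axioms = alg_axioms \<union> braid_axioms \<union>
    {(Gen Braid \<odot> (Gen Mul \<boxtimes> Idn Var),
      (Idn Var \<boxtimes> Gen Mul) \<odot> assoc \<odot> braid_first \<odot> assoc_inv \<odot> braid_last \<odot> assoc),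
     (Gen Braid \<odot> (Idn Var \<boxtimes> Gen Mul),
      (Gen Mul \<boxtimes> Idn Var) \<odot> assoc_inv \<odot> braid_last \<odot> assoc \<odot> braid_first \<odot> assoc_inv),
     (Gen Braid \<odot> (Gen Unt \<boxtimes> Idn Var) \<odot> LUnI Var, (Idn Var \<boxtimes> Gen Unt) \<odot> RUnI Var),
     (Gen Braid \<odot> (Idn Var \<boxtimes> Gen Unt) \<odot> RUnI Var, (Gen Unt \<boxtimes> Idn Var) \<odot> LUnI Var)}"

definition braid_coalg_axioms :: "(tm \<times> tm) set" where
  "braid_coalg_axioms = coalg_axioms \<union> braid_axioms \<union>
    {((Gen Comul \<boxtimes> Idn Var) \<odot> Gen Braid,
      assoc_inv \<odot> braid_last \<odot> assoc \<odot> braid_first \<odot> assoc_inv \<odot> (Idn Var \<boxtimes> Gen Comul)),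
     ((Idn Var \<boxtimes> Gen Comul) \<odot> Gen Braid,
      assoc \<odot> braid_first \<odot> assoc_inv \<odot> braid_last \<odot> assoc \<odot> (Gen Comul \<boxtimes> Idn Var)),
     (LUn Var \<odot> (Gen Counit \<boxtimes> Idn Var) \<odot> Gen Braid, RUn Var \<odot> (Idn Var \<boxtimes> Gen Counit)),
     (RUn Var \<odot> (Idn Var \<boxtimes> Gen Counit) \<odot> Gen Braid, LUn Var \<odot> (Gen Counit \<boxtimes> Idn Var))}"

definition braid_bialg_axioms :: "(tm \<times> tm) set" where
  "braid_bialg_axioms = braid_alg_axioms \<union> braid_coalg_axioms \<union>
    {(Gen Comul \<odot> Gen Mul,
      (Gen Mul \<boxtimes> Gen Mul) \<odot>
      (AscI Var Var (Tensor Var Var) \<odot>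
       (Idn Var \<boxtimes> (assoc \<odot> braid_first \<odot> assoc_inv)) \<odot>
       Asc Var Var (Tensor Var Var)) \<odot>
      (Gen Comul \<boxtimes> Gen Comul)),
     (Gen Comul \<odot> Gen Unt, (Gen Unt \<boxtimes> Gen Unt) \<odot> LUnI One),
     (Gen Counit \<odot> Gen Mul, LUn One \<odot> (Gen Counit \<boxtimes> Gen Counit)),
     (Gen Counit \<odot> Gen Unt, Idn One)}"

lemmas axioms_defs = alg_axioms_def coalg_axioms_def braid_axioms_def braid_alg_axioms_def
  braid_coalg_axioms_def braid_bialg_axioms_def

lemma well_typed_axioms_braided:
  "well_typed_axioms {Braid} braid_axioms"
  "well_typed_axioms {Mul, Unt} alg_axioms"
  "well_typed_axioms {Mul, Unt, Braid} braid_alg_axioms"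
  "well_typed_axioms {Mul, Unt, Comul, Counit, Braid} braid_bialg_axioms"
  by (simp_all add: well_typed_axioms_def axioms_defs)

text \<open>The value \<open>undefined\<close> fills the names outside the respective
  \<open>\<Sigma>\<close>, which are never inspected.\<close>

abbreviation br_ops :: "'o \<times> 'a \<Rightarrow> gen \<Rightarrow> 'a" where
  "br_ops \<equiv> \<lambda>(V, c). case_gen undefined undefined undefined undefined c"
abbreviation alg_ops :: "'o \<times> 'a \<times> 'a \<Rightarrow> gen \<Rightarrow> 'a" where
  "alg_ops \<equiv> \<lambda>(A, m, u). case_gen m u undefined undefined undefined"
abbreviation bralg_ops :: "'o \<times> 'a \<times> 'a \<times> 'a \<Rightarrow> gen \<Rightarrow> 'a" where
  "bralg_ops \<equiv> \<lambda>(A, m, u, c). case_gen m u undefined undefined c"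
abbreviation brbialg_ops :: "'o \<times> 'a \<times> 'a \<times> 'a \<times> 'a \<times> 'a \<Rightarrow> gen \<Rightarrow> 'a" where
  "brbialg_ops \<equiv> \<lambda>(B, m, u, \<Delta>, \<epsilon>, c). case_gen m u \<Delta> \<epsilon> c"

text \<open>The arrows outside \<open>\<Sigma>\<close> are arbitrary on the right. This freedom lets
  the characterisations of the parts be combined over one common assignment.\<close>

lemma is_braided_object_iff:
  "is_braided_object M V c \<longleftrightarrow> is_model M {Braid} braid_axioms V (case_gen m u \<Delta> \<epsilon> c)"
  by (simp add: is_braided_object_def is_model_def is_interpretation_def axioms_defs)

lemma is_algebra_iff:
  "is_algebra M A m u \<longleftrightarrow> is_model M {Mul, Unt} alg_axioms A (case_gen m u \<Delta> \<epsilon> c)"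
  by (simp add: is_algebra_def is_model_def is_interpretation_def axioms_defs)

lemma is_coalgebra_iff:
  "is_coalgebra M A \<Delta> \<epsilon> \<longleftrightarrow> is_model M {Comul, Counit} coalg_axioms A (case_gen m u \<Delta> \<epsilon> c)"
  by (simp add: is_coalgebra_def is_model_def is_interpretation_def axioms_defs)

lemma is_braided_algebra_iff:
  "is_braided_algebra M A m u c \<longleftrightarrow>
     is_model M {Mul, Unt, Braid} braid_alg_axioms A (case_gen m u \<Delta> \<epsilon> c)"
  unfolding is_braided_algebra_def is_algebra_iff[of _ _ _ _ \<Delta> \<epsilon> c]
    is_braided_object_iff[of _ _ _ m u \<Delta> \<epsilon>] braid_alg_axioms_def
    is_model_def is_interpretation_def ball_Un
  by (simp; blast)

lemma is_braided_coalgebra_iff: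
  "is_braided_coalgebra M A \<Delta> \<epsilon> c \<longleftrightarrow>
     is_model M {Comul, Counit, Braid} braid_coalg_axioms A (case_gen m u \<Delta> \<epsilon> c)"
  unfolding is_braided_coalgebra_def is_coalgebra_iff[of _ _ _ _ m u c]
    is_braided_object_iff[of _ _ _ m u \<Delta> \<epsilon>] braid_coalg_axioms_def
    is_model_def is_interpretation_def ball_Un
  by (simp; blast)

lemma is_braided_bialgebra_iff:
  "is_braided_bialgebra M A m u \<Delta> \<epsilon> c \<longleftrightarrow>
     is_model M {Mul, Unt, Comul, Counit, Braid} braid_bialg_axioms A (case_gen m u \<Delta> \<epsilon> c)"
  unfolding is_braided_bialgebra_def middle_braid_def is_braided_algebra_iff[of _ _ _ _ _ \<Delta> \<epsilon>]
    is_braided_coalgebra_iff[of _ _ _ _ _ m u] braid_bialg_axioms_def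
    is_model_def is_interpretation_def ball_Un
  by (simp; blast)

section \<open>The four concrete categories as categories of models\<close>

context monoidal_category
begin

lemma model_category_Br: "model_category M {Braid} (\<lambda>(V, c). V) br_ops"
proof
  fix X Y :: "'o \<times> 'a" and A h
  show "\<exists>X. (case X of (V, c) \<Rightarrow> V) = A \<and> (\<forall>g\<in>{Braid}. br_ops X g = h g)"
    by (rule exI[of _ "(A, h Braid)"]) simp
qed (auto split: prod.splits)

lemma model_category_Alg: "model_category M {Mul, Unt} (\<lambda>(A, m, u). A) alg_ops"
proof
  fix A h
  show "\<exists>X. (case X of (A, m, u) \<Rightarrow> A) = A \<and> (\<forall>g\<in>{Mul, Unt}. alg_ops X g = h g)"
    by (rule exI[of _ "(A, h Mul, h Unt)"]) simp
qed (auto split: prod.splits)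

lemma model_category_BrAlg:
  "model_category M {Mul, Unt, Braid} (\<lambda>(A, m, u, c). A) bralg_ops"
proof
  fix A h
  show "\<exists>X. (case X of (A, m, u, c) \<Rightarrow> A) = A \<and> (\<forall>g\<in>{Mul, Unt, Braid}. bralg_ops X g = h g)"
    by (rule exI[of _ "(A, h Mul, h Unt, h Braid)"]) simp
qed (auto split: prod.splits)

lemma model_category_BrBialg:
  "model_category M {Mul, Unt, Comul, Counit, Braid}
     (\<lambda>(B, m, u, \<Delta>, \<epsilon>, c). B) brbialg_ops"
proof
  fix A h
  show "\<exists>X. (case X of (B, m, u, \<Delta>, \<epsilon>, c) \<Rightarrow> B) = A \<and>
      (\<forall>g\<in>{Mul, Unt, Comul, Counit, Braid}. brbialg_ops X g = h g)"
    by (rule exI[of _ "(A, h Mul, h Unt, h Comul, h Counit, h Braid)"]) simp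
qed (auto split: prod.splits)

lemma br_hom_iff: "br_hom M c c' f \<longleftrightarrow> is_hom M {Braid} (case_gen m u \<Delta> \<epsilon> c) (case_gen m' u' \<Delta>' \<epsilon>' c') f"
  by (auto simp: br_hom_def is_hom_def)

text \<open>The square for \<open>Unt\<close> ends in \<open>u'\<close> composed with the identity
  of \<one>, which equals \<open>u'\<close> once \<open>u'\<close> is typed.\<close>

lemma alg_hom_iff:
  assumes "u' \<in> Hom M \<one> A'"
  shows "alg_hom M m u m' u' f \<longleftrightarrow>
    is_hom M {Mul, Unt} (case_gen m u \<Delta> \<epsilon> c) (case_gen m' u' \<Delta>' \<epsilon>' c') f"
  using assms by (simp add: alg_hom_def is_hom_def Hom_def)

text \<open>Dually, the identity of \<one> stands after \<epsilon>, so here the counit of the source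
  has to be typed.\<close>

lemma coalg_hom_iff:
  assumes "\<epsilon> \<in> Hom M A \<one>"
  shows "coalg_hom M \<Delta> \<epsilon> \<Delta>' \<epsilon>' f \<longleftrightarrow>
    is_hom M {Comul, Counit} (case_gen m u \<Delta> \<epsilon> c) (case_gen m' u' \<Delta>' \<epsilon>' c') f"
  using assms by (auto simp: coalg_hom_def is_hom_def Hom_def)

text \<open>The right side is spelled as \<open>models\<close> and \<open>homs\<close> unfold, so
  that general results can be folded back into statements about \<open>Br M\<close>.\<close>

lemma Br_eq:
  "Br M = structured_cat M {X. is_model M {Braid} braid_axioms (case X of (V, c) \<Rightarrow> V) (br_ops X)}
     (\<lambda>(V, c). V) (\<lambda>X Y f. is_hom M {Braid} (br_ops X) (br_ops Y) f)"
  unfolding Br_def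
proof (rule structured_cat_cong)
  show "{(V, c). is_braided_object M V c} =
      {X. is_model M {Braid} braid_axioms (case X of (V, c) \<Rightarrow> V) (br_ops X)}"
    by (auto simp flip: is_braided_object_iff)
qed (auto simp flip: br_hom_iff)

lemma Alg_eq:
  "Alg M = structured_cat M {X. is_model M {Mul, Unt} alg_axioms (case X of (A, m, u) \<Rightarrow> A) (alg_ops X)}
     (\<lambda>(A, m, u). A) (\<lambda>X Y f. is_hom M {Mul, Unt} (alg_ops X) (alg_ops Y) f)"
  unfolding Alg_def
proof (rule structured_cat_cong)
  show "{(A, m, u). is_algebra M A m u} =
      {X. is_model M {Mul, Unt} alg_axioms (case X of (A, m, u) \<Rightarrow> A) (alg_ops X)}"
    by (auto simp flip: is_algebra_iff)
  show "(case X of (A, m, u) \<Rightarrow> \<lambda>(A', m', u') f. alg_hom M m u m' u' f) Y f =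
      is_hom M {Mul, Unt} (alg_ops X) (alg_ops Y) f"
    if "Y \<in> {X. is_model M {Mul, Unt} alg_axioms (case X of (A, m, u) \<Rightarrow> A) (alg_ops X)}" for X Y f
  proof -
    obtain A m u A' m' u' where [simp]: "X = (A, m, u)" "Y = (A', m', u')"
      by (cases X; cases Y)
    have "u' \<in> Hom M \<one> A'" using that by (simp add: is_model_def is_interpretation_def)
    from alg_hom_iff[OF this] show ?thesis by simp
  qed
qed

lemma BrAlg_eq:
  "BrAlg M = structured_cat M
     {X. is_model M {Mul, Unt, Braid} braid_alg_axioms (case X of (A, m, u, c) \<Rightarrow> A) (bralg_ops X)}
     (\<lambda>(A, m, u, c). A) (\<lambda>X Y f. is_hom M {Mul, Unt, Braid} (bralg_ops X) (bralg_ops Y) f)"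
  unfolding BrAlg_def
proof (rule structured_cat_cong)
  show "{(A, m, u, c). is_braided_algebra M A m u c} =
      {X. is_model M {Mul, Unt, Braid} braid_alg_axioms (case X of (A, m, u, c) \<Rightarrow> A) (bralg_ops X)}"
    by (auto simp flip: is_braided_algebra_iff)
  show "(case X of (A, m, u, c) \<Rightarrow> \<lambda>(A', m', u', c') f. alg_hom M m u m' u' f \<and> br_hom M c c' f) Y f =
      is_hom M {Mul, Unt, Braid} (bralg_ops X) (bralg_ops Y) f"
    if "Y \<in> {X. is_model M {Mul, Unt, Braid} braid_alg_axioms (case X of (A, m, u, c) \<Rightarrow> A) (bralg_ops X)}"
    for X Y f
  proof -
    obtain A m u c A' m' u' c' where [simp]: "X = (A, m, u, c)" "Y = (A', m', u', c')"
      by (cases X; cases Y)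
    have "u' \<in> Hom M \<one> A'" using that by (simp add: is_model_def is_interpretation_def)
    from alg_hom_iff[OF this] show ?thesis
      by (simp add: br_hom_iff[of _ _ _ m u undefined undefined m' u' undefined undefined])
        (simp add: is_hom_def)
  qed
qed

lemma BrBialg_eq:
  "BrBialg M = structured_cat M
     {X. is_model M {Mul, Unt, Comul, Counit, Braid} braid_bialg_axioms
        (case X of (B, m, u, \<Delta>, \<epsilon>, c) \<Rightarrow> B) (brbialg_ops X)}
     (\<lambda>(B, m, u, \<Delta>, \<epsilon>, c). B)
     (\<lambda>X Y f. is_hom M {Mul, Unt, Comul, Counit, Braid} (brbialg_ops X) (brbialg_ops Y) f)"
  unfolding BrBialg_def
proof (rule structured_cat_cong)
  let ?S = "{X. is_model M {Mul, Unt, Comul, Counit, Braid} braid_bialg_axioms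
        (case X of (B, m, u, \<Delta>, \<epsilon>, c) \<Rightarrow> B) (brbialg_ops X)}"
  show "{(B, m, u, \<Delta>, \<epsilon>, c). is_braided_bialgebra M B m u \<Delta> \<epsilon> c} = ?S"
    by (auto simp flip: is_braided_bialgebra_iff)
  show "(case X of (B, m, u, \<Delta>, \<epsilon>, c) \<Rightarrow> \<lambda>(B', m', u', \<Delta>', \<epsilon>', c') f.
        alg_hom M m u m' u' f \<and> coalg_hom M \<Delta> \<epsilon> \<Delta>' \<epsilon>' f \<and> br_hom M c c' f) Y f =
      is_hom M {Mul, Unt, Comul, Counit, Braid} (brbialg_ops X) (brbialg_ops Y) f"
    if "X \<in> ?S" "Y \<in> ?S" for X Y f
  proof -
    obtain A m u \<Delta> \<epsilon> c A' m' u' \<Delta>' \<epsilon>' c'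
      where [simp]: "X = (A, m, u, \<Delta>, \<epsilon>, c)" "Y = (A', m', u', \<Delta>', \<epsilon>', c')"
      by (cases X; cases Y)
    have "u' \<in> Hom M \<one> A'" "\<epsilon> \<in> Hom M A \<one>"
      using that by (simp_all add: is_model_def is_interpretation_def)
    from alg_hom_iff[OF this(1)] coalg_hom_iff[OF this(2)] show ?thesis
      by (simp add: br_hom_iff[of _ _ _ m u \<Delta> \<epsilon> m' u' \<Delta>' \<epsilon>']) (simp add: is_hom_def)
  qed
qed

section \<open>Conservativity of the forgetful functors\<close>

lemma conservative_H: "is_conservative (Br M) M H"
proof -
  interpret C: model_category M "{Braid}" braid_axioms "\<lambda>(V, c). V" br_ops by (rule model_category_Br)
  show ?thesis unfolding Br_eq H_def by (rule C.is_conservative_underlying)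
qed

lemma conservative_Omega: "is_conservative (Alg M) M Omega"
proof -
  interpret C: model_category M "{Mul, Unt}" alg_axioms "\<lambda>(A, m, u). A" alg_ops by (rule model_category_Alg)
  show ?thesis unfolding Alg_eq Omega_def by (rule C.is_conservative_underlying)
qed

text \<open>Dropping the braiding is a lift of the identity functor of \<open>M\<close>, which is
  trivially conservative. The other two functors between structured categories are treated in the
  same way.\<close>

lemma conservative_H_Alg: "is_conservative (BrAlg M) (Alg M) H_Alg"
proof -
  interpret C: model_category M "{Mul, Unt, Braid}" braid_alg_axioms "\<lambda>(A, m, u, c). A" bralg_ops
    by (rule model_category_BrAlg)
  interpret D: model_category M "{Mul, Unt}" alg_axioms "\<lambda>(A, m, u). A" alg_ops
    by (rule model_category_Alg)
  interpret I: cat_functor M M id_functor by (rule cat_functor_id[OF category_axioms])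
  interpret L: structured_lift M C.models "\<lambda>(A, m, u, c). A" C.homs M D.models "\<lambda>(A, m, u). A" D.homs
    id_functor "\<lambda>(A, m, u, c). (A, m, u)"
  proof
    show "(case X of (A, m, u, c) \<Rightarrow> (A, m, u)) \<in> D.models" if "X \<in> C.models" for X
      using that by (cases X) (simp flip: is_algebra_iff is_braided_algebra_iff add: is_braided_algebra_def)
  qed (auto simp: id_functor_def is_hom_def split: prod.splits)
  show ?thesis
    using L.is_conservative_lift[OF is_conservative_id[OF category_axioms]]
    unfolding BrAlg_eq Alg_eq H_Alg_def id_functor_def by simp
qed

lemma conservative_Omega_Br: "is_conservative (BrAlg M) (Br M) Omega_Br"
proof -
  interpret C: model_category M "{Mul, Unt, Braid}" braid_alg_axioms "\<lambda>(A, m, u, c). A" bralg_ops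
    by (rule model_category_BrAlg)
  interpret D: model_category M "{Braid}" braid_axioms "\<lambda>(V, c). V" br_ops
    by (rule model_category_Br)
  interpret I: cat_functor M M id_functor by (rule cat_functor_id[OF category_axioms])
  interpret L: structured_lift M C.models "\<lambda>(A, m, u, c). A" C.homs M D.models "\<lambda>(V, c). V" D.homs
    id_functor "\<lambda>(A, m, u, c). (A, c)"
  proof
    show "(case X of (A, m, u, c) \<Rightarrow> (A, c)) \<in> D.models" if "X \<in> C.models" for X
      using that by (cases X) (simp flip: is_braided_object_iff is_braided_algebra_iff add: is_braided_algebra_def)
  qed (auto simp: id_functor_def is_hom_def split: prod.splits)
  show ?thesis
    using L.is_conservative_lift[OF is_conservative_id[OF category_axioms]]
    unfolding BrAlg_eq Br_eq Omega_Br_def id_functor_def by simp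
qed

lemma conservative_Mho_Br: "is_conservative (BrBialg M) (BrAlg M) Mho_Br"
proof -
  interpret C: model_category M "{Mul, Unt, Comul, Counit, Braid}" braid_bialg_axioms
    "\<lambda>(B, m, u, \<Delta>, \<epsilon>, c). B" brbialg_ops
    by (rule model_category_BrBialg)
  interpret D: model_category M "{Mul, Unt, Braid}" braid_alg_axioms "\<lambda>(A, m, u, c). A" bralg_ops
    by (rule model_category_BrAlg)
  interpret I: cat_functor M M id_functor by (rule cat_functor_id[OF category_axioms])
  interpret L: structured_lift M C.models "\<lambda>(B, m, u, \<Delta>, \<epsilon>, c). B" C.homs
    M D.models "\<lambda>(A, m, u, c). A" D.homs id_functor "\<lambda>(B, m, u, \<Delta>, \<epsilon>, c). (B, m, u, c)"
  proof
    show "(case X of (B, m, u, \<Delta>, \<epsilon>, c) \<Rightarrow> (B, m, u, c)) \<in> D.models" if "X \<in> C.models" for X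
      using that by (cases X)
        (simp flip: is_braided_algebra_iff is_braided_bialgebra_iff add: is_braided_bialgebra_def)
  qed (auto simp: id_functor_def is_hom_def split: prod.splits)
  show ?thesis
    using L.is_conservative_lift[OF is_conservative_id[OF category_axioms]]
    unfolding BrBialg_eq BrAlg_eq Mho_Br_def id_functor_def by simp
qed

end

section \<open>The four induced functors as lifts of \<open>F\<close>\<close>

context monoidal_functor
begin

lemma model_lift_Br:
  "model_lift M M' F \<phi>0 \<phi>2 {Braid} braid_axioms (\<lambda>(V, c). V) br_ops (\<lambda>(V, c). V) br_ops
     (\<lambda>(V, c). (OMap F V, ind_c M' F \<phi>2 V c))"
  by (intro model_lift.intro model_lift_axioms.intro monoidal_functor_axioms
      source.model_category_Br target.model_category_Br well_typed_axioms_braided)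
    (auto split: prod.splits)

lemma model_lift_Alg:
  "model_lift M M' F \<phi>0 \<phi>2 {Mul, Unt} alg_axioms (\<lambda>(A, m, u). A) alg_ops (\<lambda>(A, m, u). A) alg_ops
     (\<lambda>(A, m, u). (OMap F A, ind_m M' F \<phi>2 A m, ind_u M' F \<phi>0 u))"
  by (intro model_lift.intro model_lift_axioms.intro monoidal_functor_axioms
      source.model_category_Alg target.model_category_Alg well_typed_axioms_braided)
    (auto split: prod.splits)

lemma model_lift_BrAlg:
  "model_lift M M' F \<phi>0 \<phi>2 {Mul, Unt, Braid} braid_alg_axioms
     (\<lambda>(A, m, u, c). A) bralg_ops (\<lambda>(A, m, u, c). A) bralg_ops
     (\<lambda>(A, m, u, c). (OMap F A, ind_m M' F \<phi>2 A m, ind_u M' F \<phi>0 u, ind_c M' F \<phi>2 A c))"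
  by (intro model_lift.intro model_lift_axioms.intro monoidal_functor_axioms
      source.model_category_BrAlg target.model_category_BrAlg well_typed_axioms_braided)
    (auto split: prod.splits)

lemma model_lift_BrBialg:
  "model_lift M M' F \<phi>0 \<phi>2 {Mul, Unt, Comul, Counit, Braid} braid_bialg_axioms
     (\<lambda>(B, m, u, \<Delta>, \<epsilon>, c). B) brbialg_ops (\<lambda>(B, m, u, \<Delta>, \<epsilon>, c). B) brbialg_ops
     (\<lambda>(B, m, u, \<Delta>, \<epsilon>, c).
        (OMap F B, ind_m M' F \<phi>2 B m, ind_u M' F \<phi>0 u,
         ind_Delta M' F \<phi>2 B \<Delta>, ind_eps M' F \<phi>0 \<epsilon>, ind_c M' F \<phi>2 B c))"
  by (intro model_lift.intro model_lift_axioms.intro monoidal_functor_axioms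
      source.model_category_BrBialg target.model_category_BrBialg well_typed_axioms_braided)
    (auto split: prod.splits)

lemmas BrF_properties = model_lift.properties[OF model_lift_Br,
  folded BrF_def source.Br_eq target.Br_eq]
lemmas AlgF_properties = model_lift.properties[OF model_lift_Alg,
  folded AlgF_def source.Alg_eq target.Alg_eq]
lemmas BrAlgF_properties = model_lift.properties[OF model_lift_BrAlg,
  folded BrAlgF_def source.BrAlg_eq target.BrAlg_eq]
lemmas BrBialgF_properties = model_lift.properties[OF model_lift_BrBialg,
  folded BrBialgF_def source.BrBialg_eq target.BrBialg_eq]

end

text \<open>The five equalities hold as equalities of records, since both sides apply the same
  formulas even outside the carriers; it remains to see that one side is a functor.\<close>

lemma functor_eqI: "F = G \<Longrightarrow> cat_functor C D F \<Longrightarrow> functor_eq C D F G"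
  by (simp add: functor_eq_def)

lemmas functor_defs = comp_functor_def structured_functor_def underlying_functor_def
  H_def Omega_def H_Alg_def Omega_Br_def Mho_Br_def BrF_def AlgF_def BrAlgF_def BrBialgF_def

theorem proposition2p5:
  fixes M :: "('o, 'a) moncat" and M' :: "('p, 'b) moncat"
    and F :: "('o, 'a, 'p, 'b) fctr" and \<phi>0 :: 'b and \<phi>2 :: "'o \<Rightarrow> 'o \<Rightarrow> 'b"
  assumes "monoidal_category M" and "monoidal_category M'"
    and "monoidal_functor M M' F \<phi>0 \<phi>2"
  shows
    "(cat_functor (Br M) (Br M') (BrF M' F \<phi>2) \<and>
     cat_functor (Alg M) (Alg M') (AlgF M' F \<phi>0 \<phi>2) \<and>
     cat_functor (BrAlg M) (BrAlg M') (BrAlgF M' F \<phi>0 \<phi>2) \<and>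
     cat_functor (BrBialg M) (BrBialg M') (BrBialgF M' F \<phi>0 \<phi>2)) \<and>
    (functor_eq (Br M) M' (H \<circ>\<^sub>F BrF M' F \<phi>2) (F \<circ>\<^sub>F H) \<and>
     functor_eq (Alg M) M' (Omega \<circ>\<^sub>F AlgF M' F \<phi>0 \<phi>2) (F \<circ>\<^sub>F Omega) \<and>
     functor_eq (BrAlg M) (Alg M') (H_Alg \<circ>\<^sub>F BrAlgF M' F \<phi>0 \<phi>2) (AlgF M' F \<phi>0 \<phi>2 \<circ>\<^sub>F H_Alg) \<and>
     functor_eq (BrAlg M) (Br M') (Omega_Br \<circ>\<^sub>F BrAlgF M' F \<phi>0 \<phi>2) (BrF M' F \<phi>2 \<circ>\<^sub>F Omega_Br) \<and>
     functor_eq (BrBialg M) (BrAlg M')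
       (Mho_Br \<circ>\<^sub>F BrBialgF M' F \<phi>0 \<phi>2) (BrAlgF M' F \<phi>0 \<phi>2 \<circ>\<^sub>F Mho_Br)) \<and>
    (is_conservative (Br M) M H \<and>
     is_conservative (Alg M) M Omega \<and>
     is_conservative (BrAlg M) (Alg M) H_Alg \<and>
     is_conservative (BrAlg M) (Br M) Omega_Br \<and>
     is_conservative (BrBialg M) (BrAlg M) Mho_Br) \<and>
    (is_equivalence M M' F \<longrightarrow>
       is_equivalence (Br M) (Br M') (BrF M' F \<phi>2) \<and>
       is_equivalence (Alg M) (Alg M') (AlgF M' F \<phi>0 \<phi>2) \<and>
       is_equivalence (BrAlg M) (BrAlg M') (BrAlgF M' F \<phi>0 \<phi>2) \<and>
       is_equivalence (BrBialg M) (BrBialg M') (BrBialgF M' F \<phi>0 \<phi>2)) \<and>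
     (is_cat_isomorphism M M' F \<longrightarrow>
       is_cat_isomorphism (Br M) (Br M') (BrF M' F \<phi>2) \<and>
       is_cat_isomorphism (Alg M) (Alg M') (AlgF M' F \<phi>0 \<phi>2) \<and>
       is_cat_isomorphism (BrAlg M) (BrAlg M') (BrAlgF M' F \<phi>0 \<phi>2) \<and>
       is_cat_isomorphism (BrBialg M) (BrBialg M') (BrBialgF M' F \<phi>0 \<phi>2)) \<and>
     (is_conservative M M' F \<longrightarrow>
       is_conservative (Br M) (Br M') (BrF M' F \<phi>2) \<and>
       is_conservative (Alg M) (Alg M') (AlgF M' F \<phi>0 \<phi>2) \<and>
       is_conservative (BrAlg M) (BrAlg M') (BrAlgF M' F \<phi>0 \<phi>2) \<and>
       is_conservative (BrBialg M) (BrBialg M') (BrBialgF M' F \<phi>0 \<phi>2))"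
proof -
  interpret monoidal_functor M M' F \<phi>0 \<phi>2 by fact
  note conservative = source.conservative_H source.conservative_Omega source.conservative_H_Alg
    source.conservative_Omega_Br source.conservative_Mho_Br
  note conservative' = target.conservative_H target.conservative_Omega target.conservative_H_Alg
    target.conservative_Omega_Br target.conservative_Mho_Br
  \<comment> \<open>\<open>is_conservative\<close> includes being a functor, so functoriality of the
    primed forgetful functors is read off from it.\<close>
  note forgetful = conservative'[unfolded is_conservative_def, THEN conjunct1]
  have "functor_eq (Br M) M' (H \<circ>\<^sub>F BrF M' F \<phi>2) (F \<circ>\<^sub>F H)"
    by (rule functor_eqI[OF _ cat_functor_comp[OF BrF_properties(1) forgetful(1)]])
      (auto simp: functor_defs fun_eq_iff)
  moreover have "functor_eq (Alg M) M' (Omega \<circ>\<^sub>F AlgF M' F \<phi>0 \<phi>2) (F \<circ>\<^sub>F Omega)"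
    by (rule functor_eqI[OF _ cat_functor_comp[OF AlgF_properties(1) forgetful(2)]])
      (auto simp: functor_defs fun_eq_iff)
  moreover have "functor_eq (BrAlg M) (Alg M')
      (H_Alg \<circ>\<^sub>F BrAlgF M' F \<phi>0 \<phi>2) (AlgF M' F \<phi>0 \<phi>2 \<circ>\<^sub>F H_Alg)"
    by (rule functor_eqI[OF _ cat_functor_comp[OF BrAlgF_properties(1) forgetful(3)]])
      (auto simp: functor_defs fun_eq_iff)
  moreover have "functor_eq (BrAlg M) (Br M')
      (Omega_Br \<circ>\<^sub>F BrAlgF M' F \<phi>0 \<phi>2) (BrF M' F \<phi>2 \<circ>\<^sub>F Omega_Br)"
    by (rule functor_eqI[OF _ cat_functor_comp[OF BrAlgF_properties(1) forgetful(4)]])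
      (auto simp: functor_defs fun_eq_iff)
  moreover have "functor_eq (BrBialg M) (BrAlg M')
      (Mho_Br \<circ>\<^sub>F BrBialgF M' F \<phi>0 \<phi>2) (BrAlgF M' F \<phi>0 \<phi>2 \<circ>\<^sub>F Mho_Br)"
    by (rule functor_eqI[OF _ cat_functor_comp[OF BrBialgF_properties(1) forgetful(5)]])
      (auto simp: functor_defs fun_eq_iff)
  ultimately show ?thesis
    using conservative BrF_properties AlgF_properties BrAlgF_properties BrBialgF_properties
    by (intro conjI impI)
qed

end
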